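(* Let $F$ be a free group with at least three generators (that is, free of rank at least $3$). Then there is no reduced plane curve $C \subset \mathbb{C}^2$ in general position at infinity such that $\pi_1(\mathbb{C}^2 \setminus C) \cong F$.
   Context: A plane curve $C = \{f(x,y) = 0\} \subset \mathbb{C}^2$ is in general position at infinity if its projective completion in $\mathbb{C}\mathbb{P}^2$ is transverse to the line at infinity. *)

theory Defs
  imports
    "HOL-Analysis.Analysis"
    "HOL-Algebra.Group"
    "HOL-Computational_Algebra.Computational_Algebra"
begin

section \<open>Plane curves\<close>

text \<open>
  An element \<open>f\<close> of \<open>\<complex>[x,y]\<close> is represented as a \<^typ>\<open>complex poly poly\<close>: the outer
  variable is \<open>y\<close>, the inner one is \<open>x\<close>, so \<^term>\<open>coeff (coeff f j) i\<close> is the coefficient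
  of \<open>x\<^sup>i y\<^sup>j\<close>.
\<close>

definition poly2 :: "complex poly poly \<Rightarrow> complex \<Rightarrow> complex \<Rightarrow> complex" where
  "poly2 f x y = poly (poly f [:y:]) x"

definition total_degree :: "complex poly poly \<Rightarrow> nat" where
  "total_degree f = (LEAST d. \<forall>i j. coeff (coeff f j) i \<noteq> 0 \<longrightarrow> i + j \<le> d)"

definition affine_curve :: "complex poly poly \<Rightarrow> (complex \<times> complex) set" where
  "affine_curve f = {(x, y). poly2 f x y = 0}"

definition reduced_plane_curve :: "complex poly poly \<Rightarrow> bool" where
  "reduced_plane_curve f \<longleftrightarrow> total_degree f > 0 \<and> squarefree f"

section \<open>Behaviour at infinity\<close>

text \<open>
  Points of the projective plane are handled through homogeneous coordinates \<open>(x, y, z) \<noteq> (0, 0, 0)\<close>, the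
  affine plane being \<open>z \<noteq> 0\<close> and the line at infinity \<open>z = 0\<close>. All the conditions below are
  invariant under rescaling \<open>(x, y, z)\<close>.
\<close>

definition homogenization :: "complex poly poly \<Rightarrow> complex \<Rightarrow> complex \<Rightarrow> complex \<Rightarrow> complex" where
  "homogenization f x y z =
     (\<Sum>(i, j) \<in> {(i, j). i + j \<le> total_degree f}.
        coeff (coeff f j) i * x ^ i * y ^ j * z ^ (total_degree f - (i + j)))"

definition projective_completion :: "complex poly poly \<Rightarrow> (complex \<times> complex \<times> complex) set" where
  "projective_completion f = {(x, y, z). (x, y, z) \<noteq> (0, 0, 0) \<and> homogenization f x y z = 0}"

definition line_at_infinity :: "(complex \<times> complex \<times> complex) set" where
  "line_at_infinity = {(x, y, z). (x, y, z) \<noteq> (0, 0, 0) \<and> z = 0}"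

definition gradient :: "(complex \<Rightarrow> complex \<Rightarrow> complex \<Rightarrow> complex) \<Rightarrow>
    complex \<times> complex \<times> complex \<Rightarrow> complex \<times> complex \<times> complex" where
  "gradient F = (\<lambda>(x, y, z).
     (deriv (\<lambda>t. F t y z) x, deriv (\<lambda>t. F x t z) y, deriv (\<lambda>t. F x y t) z))"

definition smooth_at :: "complex poly poly \<Rightarrow> complex \<times> complex \<times> complex \<Rightarrow> bool" where
  "smooth_at f p \<longleftrightarrow> gradient (homogenization f) p \<noteq> (0, 0, 0)"

text \<open>The projective tangent line, meaningful at smooth points.\<close>

definition tangent_line :: "complex poly poly \<Rightarrow> complex \<times> complex \<times> complex \<Rightarrow>
    (complex \<times> complex \<times> complex) set" where
  "tangent_line f p = {(u, v, w). (u, v, w) \<noteq> (0, 0, 0) \<and>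
     (case gradient (homogenization f) p of (a, b, c) \<Rightarrow> a * u + b * v + c * w = 0)}"

definition general_position_at_infinity :: "complex poly poly \<Rightarrow> bool" where
  "general_position_at_infinity f \<longleftrightarrow>
     (\<forall>p \<in> projective_completion f \<inter> line_at_infinity.
        smooth_at f p \<and> tangent_line f p \<noteq> line_at_infinity)"

section \<open>The fundamental group\<close>

definition loops_at :: "'a::real_normed_vector set \<Rightarrow> 'a \<Rightarrow> (real \<Rightarrow> 'a) set" where
  "loops_at S b = {p. path p \<and> path_image p \<subseteq> S \<and> pathstart p = b \<and> pathfinish p = b}"

definition path_class :: "'a::real_normed_vector set \<Rightarrow> (real \<Rightarrow> 'a) \<Rightarrow> (real \<Rightarrow> 'a) set" where
  "path_class S p = {q. homotopic_paths S p q}"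

definition fundamental_group ::
    "'a::real_normed_vector set \<Rightarrow> 'a \<Rightarrow> (real \<Rightarrow> 'a) set monoid" where
  "fundamental_group S b =
     \<lparr>carrier = path_class S ` loops_at S b,
      monoid.mult = (\<lambda>A B. {r. \<exists>p\<in>A. \<exists>q\<in>B. homotopic_paths S (p +++ q) r}),
      one = path_class S (linepath b b)\<rparr>"

lemma path_class_eq_iff:
  assumes "p \<in> loops_at S b"
  shows "path_class S p = path_class S q \<longleftrightarrow> homotopic_paths S p q"
  using assms unfolding path_class_def loops_at_def
  by (auto intro: homotopic_paths_trans homotopic_paths_sym)

lemma loops_at_join: "p \<in> loops_at S b \<Longrightarrow> q \<in> loops_at S b \<Longrightarrow> p +++ q \<in> loops_at S b"
  by (auto simp: loops_at_def path_image_join)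

lemma loops_at_reversepath: "p \<in> loops_at S b \<Longrightarrow> reversepath p \<in> loops_at S b"
  by (auto simp: loops_at_def)

lemma loops_at_const: "b \<in> S \<Longrightarrow> linepath b b \<in> loops_at S b"
  by (auto simp: loops_at_def)

lemma fundamental_group_mult:
  assumes "p \<in> loops_at S b" "q \<in> loops_at S b"
  shows "path_class S p \<otimes>\<^bsub>fundamental_group S b\<^esub> path_class S q = path_class S (p +++ q)"
proof -
  have pq: "path p" "path_image p \<subseteq> S" "path q" "path_image q \<subseteq> S" "pathfinish p = pathstart q"
    using assms by (auto simp: loops_at_def)
  have "homotopic_paths S (p +++ q) r"
    if "homotopic_paths S p p'" "homotopic_paths S q q'" "homotopic_paths S (p' +++ q') r" for p' q' r
    using homotopic_paths_join[OF that(1,2) pq(5)] that(3) by (rule homotopic_paths_trans)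
  moreover have "homotopic_paths S p p" "homotopic_paths S q q"
    using pq by auto
  ultimately have "(\<exists>p'. homotopic_paths S p p' \<and> (\<exists>q'. homotopic_paths S q q' \<and>
      homotopic_paths S (p' +++ q') r)) \<longleftrightarrow> homotopic_paths S (p +++ q) r" for r
    by blast
  then show ?thesis
    by (simp add: fundamental_group_def path_class_def)
qed

lemma group_fundamental_group:
  assumes "b \<in> S"
  shows "group (fundamental_group S b)" (is "group ?G")
proof (rule groupI)
  have carrier: "carrier ?G = path_class S ` loops_at S b"
    and one: "\<one>\<^bsub>?G\<^esub> = path_class S (linepath b b)"
    by (simp_all add: fundamental_group_def)
  note L = loops_at_join loops_at_reversepath loops_at_const[OF assms]
  show "\<one>\<^bsub>?G\<^esub> \<in> carrier ?G"
    using L by (simp add: carrier one)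
  fix x assume "x \<in> carrier ?G"
  then obtain p where p: "x = path_class S p" "p \<in> loops_at S b"
    by (auto simp: carrier)
  have "homotopic_paths S (linepath b b +++ p) p"
    using p by (intro homotopic_paths_lid') (auto simp: loops_at_def)
  then have "path_class S (linepath b b +++ p) = path_class S p"
    by (simp add: path_class_eq_iff[OF loops_at_join[OF L(3) p(2)]])
  then show "\<one>\<^bsub>?G\<^esub> \<otimes>\<^bsub>?G\<^esub> x = x"
    using p by (simp add: one fundamental_group_mult L)
  have "homotopic_paths S (reversepath p +++ p) (linepath b b)"
    using p homotopic_paths_linv[of p S] by (auto simp: loops_at_def)
  then have "path_class S (reversepath p +++ p) = path_class S (linepath b b)"
    by (simp add: path_class_eq_iff[OF loops_at_join[OF loops_at_reversepath[OF p(2)] p(2)]])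
  then have "path_class S (reversepath p) \<otimes>\<^bsub>?G\<^esub> x = \<one>\<^bsub>?G\<^esub>"
    using p by (simp add: one fundamental_group_mult L)
  then show "\<exists>y\<in>carrier ?G. y \<otimes>\<^bsub>?G\<^esub> x = \<one>\<^bsub>?G\<^esub>"
    unfolding carrier using imageI[OF loops_at_reversepath[OF p(2)]] by (rule bexI)
  fix y assume "y \<in> carrier ?G"
  then obtain q where q: "y = path_class S q" "q \<in> loops_at S b"
    by (auto simp: carrier)
  show "x \<otimes>\<^bsub>?G\<^esub> y \<in> carrier ?G"
    using p q by (simp add: carrier fundamental_group_mult L)
  fix z assume "z \<in> carrier ?G"
  then obtain r where r: "z = path_class S r" "r \<in> loops_at S b"
    by (auto simp: carrier)
  have "homotopic_paths S ((p +++ q) +++ r) (p +++ (q +++ r))"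
    using p q r by (intro homotopic_paths_sym[OF homotopic_paths_assoc]) (auto simp: loops_at_def)
  then have "path_class S ((p +++ q) +++ r) = path_class S (p +++ (q +++ r))"
    by (simp add: path_class_eq_iff[OF loops_at_join[OF loops_at_join[OF p(2) q(2)] r(2)]])
  then show "x \<otimes>\<^bsub>?G\<^esub> y \<otimes>\<^bsub>?G\<^esub> z = x \<otimes>\<^bsub>?G\<^esub> (y \<otimes>\<^bsub>?G\<^esub> z)"
    using p q r by (simp add: fundamental_group_mult L)
qed

section \<open>Free groups\<close>

text \<open>
  A letter \<open>(x, True)\<close> stands for \<open>x\<close> and \<open>(x, False)\<close> for its inverse. A group is free with
  basis \<open>X\<close> if every element is the value of exactly one reduced word over \<open>X\<close>; its rank is
  then the cardinality of \<open>X\<close>.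
\<close>

definition letter_value :: "('a, 'b) monoid_scheme \<Rightarrow> 'a \<times> bool \<Rightarrow> 'a" where
  "letter_value G = (\<lambda>(x, e). if e then x else inv\<^bsub>G\<^esub> x)"

primrec word_value :: "('a, 'b) monoid_scheme \<Rightarrow> ('a \<times> bool) list \<Rightarrow> 'a" where
  "word_value G [] = \<one>\<^bsub>G\<^esub>"
| "word_value G (l # w) = letter_value G l \<otimes>\<^bsub>G\<^esub> word_value G w"

definition reduced_words :: "'a set \<Rightarrow> ('a \<times> bool) list set" where
  "reduced_words X = {w \<in> lists (X \<times> UNIV).
     successively (\<lambda>(x, e) (x', e'). \<not> (x = x' \<and> e \<noteq> e')) w}"

definition free_basis :: "('a, 'b) monoid_scheme \<Rightarrow> 'a set \<Rightarrow> bool" where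
  "free_basis G X \<longleftrightarrow>
     X \<subseteq> carrier G \<and> bij_betw (word_value G) (reduced_words X) (carrier G)"

end

theory Submission
  imports Defs "HOL-Complex_Analysis.Winding_Numbers" "Subresultants.Subresultant_Gcd"
    "HOL-Computational_Algebra.Field_as_Ring"
begin

text \<open>
  The fundamental group of the complement of a plane curve that is transverse to the line at
  infinity has a central element different from the identity, whereas a free group of rank at
  least two has trivial centre (\<open>free_basis_trivial_center\<close>). These two facts exclude each other.

  The central element is a rotation loop \<open>t \<mapsto> e\<^sup>2\<^sup>\<pi>\<^sup>i\<^sup>t w\<close> through a point \<open>w\<close> far from the curve.
  It is not null-homotopic because the equation \<open>f\<close> of the curve maps it to a loop in the punctured
  plane that winds around \<open>0\<close> as often as the degree of \<open>f\<close> says (\<open>winding_orbit\<close>,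
  \<open>rotation_loop_nontrivial\<close>).

  For the centrality, call a path \<open>p\<close> central if the rotation loops at its two ends correspond to
  each other under \<open>p\<close>. Paths inside the set of points whose whole circle orbit avoids the curve
  are central, since the circle action turns them into a torus (\<open>central_in_rot_region\<close>). All other
  paths are reduced to these in two steps, which replace the classical theorem of Zariski and
  van Kampen. First, every path is a product of short pieces, and a short piece is homotopic to a
  path far away from the curve up to paths in vertical lines \<open>x = const\<close> (\<open>central_all\<close>). Secondly, a
  path in a vertical line with both ends far away is moved to the line at infinity:
  after a small perturbation of \<open>x\<close> the lines over the ray \<open>{s x. s \<ge> 1}\<close> meet the curve in \<open>d\<close>
  distinct points, and so does the limit at infinity, by transversality. The \<open>d\<close> points move
  continuously along the ray, and a path in the complement of them can be pushed along
  (\<open>transport_near\<close>). In the limit the equation becomes homogeneous, hence its zero set is invariant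
  under the circle action, and the path ends up in the region treated before
  (\<open>central_vertical_generic\<close>).

  A shear of the coordinates makes \<open>f\<close> monic in \<open>y\<close> up to a constant. That only
  finitely many vertical lines meet the curve in fewer than \<open>d\<close> points is read off from a
  resultant (\<open>finite_not_rsquarefree\<close>), and Euler's identity turns the transversality at infinity into the
  simplicity of the roots there (\<open>rsquarefree_at_infinity\<close>).
\<close>

section \<open>The centre of a free group\<close>

lemma (in group) letter_value_closed: "fst l \<in> carrier G \<Longrightarrow> letter_value G l \<in> carrier G"
  by (cases l) (simp add: letter_value_def)

lemma (in group) word_value_closed:
  "fst ` set w \<subseteq> carrier G \<Longrightarrow> word_value G w \<in> carrier G"
  by (induction w) (auto simp: letter_value_closed)

lemma (in group) word_value_append:
  "fst ` set u \<subseteq> carrier G \<Longrightarrow> fst ` set v \<subseteq> carrier G \<Longrightarrow>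
    word_value G (u @ v) = word_value G u \<otimes> word_value G v"
  by (induction u) (auto simp: letter_value_closed word_value_closed m_assoc)

text \<open>
  If the reduced word \<open>w\<close> of a central element were nonempty, take a letter \<open>l\<close> over a generator
  other than that of the first letter of \<open>w\<close>, with the sign of the last letter of \<open>w\<close>. Then \<open>l\<close> cancels neither
  in front of \<open>w\<close> nor behind it, so \<open>l # w\<close> and \<open>w @ [l]\<close> are reduced words of the same
  element; they differ in their first letter.
\<close>
lemma free_basis_trivial_center:
  assumes "group G" and basis: "free_basis G X"
    and X: "x0 \<in> X" "x1 \<in> X" "x0 \<noteq> x1"
    and z: "z \<in> carrier G" and central: "\<And>g. g \<in> carrier G \<Longrightarrow> g \<otimes>\<^bsub>G\<^esub> z = z \<otimes>\<^bsub>G\<^esub> g"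
  shows "z = \<one>\<^bsub>G\<^esub>"
proof -
  interpret group G by fact
  have XG: "X \<subseteq> carrier G" and bij: "bij_betw (word_value G) (reduced_words X) (carrier G)"
    using basis by (auto simp: free_basis_def)
  obtain w where w: "w \<in> reduced_words X" "word_value G w = z"
    using bij z by (metis bij_betw_iff_bijections)
  show ?thesis
  proof (cases "w = []")
    case True
    then show ?thesis using w by simp
  next
    case False
    obtain y where y: "y \<in> X" "y \<noteq> fst (hd w)"
      using X by metis
    define l where "l = (y, snd (last w))"
    have wX: "fst ` set w \<subseteq> X"
      using w(1) by (auto simp: reduced_words_def)
    have "l # w \<in> reduced_words X"
      using w(1) False y by (cases w) (auto simp: reduced_words_def l_def)
    moreover have "w @ [l] \<in> reduced_words X"
      using w(1) False y
      by (cases "last w") (auto simp: reduced_words_def l_def successively_append_iff)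
    moreover have "word_value G (l # w) = word_value G (w @ [l])"
    proof -
      have "letter_value G l \<in> carrier G"
        using y XG by (auto simp: l_def letter_value_closed)
      moreover have "word_value G (w @ [l]) = word_value G w \<otimes>\<^bsub>G\<^esub> word_value G [l]"
        using wX y XG by (intro word_value_append) (auto simp: l_def)
      ultimately show ?thesis
        using w(2) central by simp
    qed
    ultimately have "l # w = w @ [l]"
      using bij by (meson bij_betw_def inj_onD)
    then have "l = hd w"
      using False by (metis hd_append2 list.sel(1))
    then show ?thesis
      using y unfolding l_def by (metis fst_conv)
  qed
qed

lemma center_loop_not_free:
  fixes S :: "'c::real_normed_vector set" and F :: "('a, 'b) monoid_scheme"
  assumes b: "b \<in> S" and g: "g \<in> loops_at S b"
    and central: "\<And>p. p \<in> loops_at S b \<Longrightarrow> homotopic_paths S (p +++ g) (g +++ p)"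
    and nontrivial: "\<not> homotopic_paths S g (linepath b b)"
    and F: "group F" "free_basis F X" and X: "x0 \<in> X" "x1 \<in> X" "x0 \<noteq> x1"
  shows "\<not> fundamental_group S b \<cong> F"
proof
  let ?G = "fundamental_group S b"
  assume "?G \<cong> F"
  then obtain \<phi> where \<phi>: "\<phi> \<in> iso ?G F" by (auto simp: is_iso_def)
  have hom: "\<phi> \<in> hom ?G F" and bij: "bij_betw \<phi> (carrier ?G) (carrier F)"
    using \<phi> by (auto simp: iso_def)
  have G: "group ?G" using b by (rule group_fundamental_group)
  interpret group_hom ?G F \<phi>
    using G F hom by (simp add: group_hom_def group_hom_axioms_def)
  define z where "z = path_class S g"
  have carrier: "carrier ?G = path_class S ` loops_at S b"
    by (simp add: fundamental_group_def)
  have z: "z \<in> carrier ?G" using g by (simp add: carrier z_def)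
  have "\<phi> z = \<one>\<^bsub>F\<^esub>"
  proof (rule free_basis_trivial_center[OF F X])
    show "\<phi> z \<in> carrier F" using z by simp
    fix h assume "h \<in> carrier F"
    then obtain k where k: "k \<in> carrier ?G" "h = \<phi> k"
      using bij by (auto simp: bij_betw_def)
    then obtain p where p: "p \<in> loops_at S b" "k = path_class S p"
      by (auto simp: carrier)
    have "k \<otimes>\<^bsub>?G\<^esub> z = z \<otimes>\<^bsub>?G\<^esub> k"
      using central[OF p(1)] p g
      by (simp add: z_def fundamental_group_mult path_class_eq_iff[OF loops_at_join])
    then show "h \<otimes>\<^bsub>F\<^esub> \<phi> z = \<phi> z \<otimes>\<^bsub>F\<^esub> h"
      using k z by (metis hom_mult)
  qed
  then have "\<phi> z = \<phi> \<one>\<^bsub>?G\<^esub>" by simp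
  then have "z = \<one>\<^bsub>?G\<^esub>"
    using bij z by (meson G.one_closed bij_betw_imp_inj_on inj_onD)
  then have "homotopic_paths S g (linepath b b)"
    using g path_class_eq_iff[OF g] by (simp add: z_def fundamental_group_def)
  with nontrivial show False by contradiction
qed

section \<open>Paths along which a family of loops is natural\<close>

text \<open>
  Naturality of the loops \<open>\<Gamma> x\<close> under transport along \<open>p\<close>. When it holds for all loops at a point
  \<open>b\<close>, the class of \<open>\<Gamma> b\<close> is central in the fundamental group.
\<close>
definition commutes_along ::
    "'a::real_normed_vector set \<Rightarrow> ('a \<Rightarrow> real \<Rightarrow> 'a) \<Rightarrow> (real \<Rightarrow> 'a) \<Rightarrow> bool" where
  "commutes_along S \<Gamma> p \<longleftrightarrow> path p \<and> path_image p \<subseteq> S \<and>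
     homotopic_paths S (p +++ \<Gamma> (pathfinish p)) (\<Gamma> (pathstart p) +++ p)"

locale loop_family =
  fixes S :: "'a::real_normed_vector set" and \<Gamma> :: "'a \<Rightarrow> real \<Rightarrow> 'a"
  assumes loop: "x \<in> S \<Longrightarrow> \<Gamma> x \<in> loops_at S x"
begin

lemma loop_simps [simp]:
  assumes "x \<in> S"
  shows "path (\<Gamma> x)" "path_image (\<Gamma> x) \<subseteq> S" "pathstart (\<Gamma> x) = x" "pathfinish (\<Gamma> x) = x"
  using loop[OF assms] by (auto simp: loops_at_def)

lemma commutes_along_homotopic:
  assumes p: "commutes_along S \<Gamma> p" and pq: "homotopic_paths S p q"
  shows "commutes_along S \<Gamma> q"
proof -
  have e: "pathstart q = pathstart p" "pathfinish q = pathfinish p"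
    using pq by (auto dest: homotopic_paths_imp_pathstart homotopic_paths_imp_pathfinish)
  have P: "path p" "path_image p \<subseteq> S" "path q" "path_image q \<subseteq> S"
    using homotopic_paths_imp_path[OF pq] homotopic_paths_imp_subset[OF pq] by auto
  then have S: "pathstart p \<in> S" "pathfinish p \<in> S" by auto
  have "homotopic_paths S (q +++ \<Gamma> (pathfinish p)) (p +++ \<Gamma> (pathfinish p))"
    using pq S e by (intro homotopic_paths_join) (auto simp: homotopic_paths_sym)
  moreover have "homotopic_paths S (\<Gamma> (pathstart p) +++ p) (\<Gamma> (pathstart p) +++ q)"
    using pq S e by (intro homotopic_paths_join) auto
  ultimately show ?thesis
    using p P e unfolding commutes_along_def by (auto intro: homotopic_paths_trans)
qed

lemma commutes_along_cong:
  assumes "commutes_along S \<Gamma> p" "\<And>t. t \<in> {0..1} \<Longrightarrow> p t = q t"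
  shows "commutes_along S \<Gamma> q"
  using assms by (intro commutes_along_homotopic[OF assms(1)] homotopic_paths_eq) (auto simp: commutes_along_def)

lemma commutes_along_join:
  assumes p: "commutes_along S \<Gamma> p" and q: "commutes_along S \<Gamma> q"
    and pq: "pathfinish p = pathstart q"
  shows "commutes_along S \<Gamma> (p +++ q)"
proof -
  define a b c where "a = \<Gamma> (pathstart p)" "b = \<Gamma> (pathfinish p)" "c = \<Gamma> (pathfinish q)"
  have P: "path p" "path_image p \<subseteq> S" "path q" "path_image q \<subseteq> S"
    using p q by (auto simp: commutes_along_def)
  then have S: "pathstart p \<in> S" "pathfinish p \<in> S" "pathstart q \<in> S" "pathfinish q \<in> S" by auto
  note abc = a_b_c_def P S pq path_image_join
  have hp: "homotopic_paths S (p +++ b) (a +++ p)"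
    using p by (simp add: commutes_along_def abc)
  have hq: "homotopic_paths S (q +++ c) (b +++ q)"
    using q by (simp add: commutes_along_def abc)
  have "homotopic_paths S ((p +++ q) +++ c) (p +++ (q +++ c))"
    by (rule homotopic_paths_sym[OF homotopic_paths_assoc]) (simp_all add: abc)
  also have "homotopic_paths S \<dots> (p +++ (b +++ q))"
    by (intro homotopic_paths_join hq) (simp_all add: abc)
  also have "homotopic_paths S \<dots> ((p +++ b) +++ q)"
    by (rule homotopic_paths_assoc) (simp_all add: abc)
  also have "homotopic_paths S \<dots> ((a +++ p) +++ q)"
    by (intro homotopic_paths_join hp) (simp_all add: abc)
  also have "homotopic_paths S \<dots> (a +++ (p +++ q))"
    by (rule homotopic_paths_sym[OF homotopic_paths_assoc]) (simp_all add: abc)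
  finally show ?thesis
    using P pq by (auto simp: commutes_along_def a_b_c_def path_image_join)
qed

lemma commutes_along_reversepath:
  assumes p: "commutes_along S \<Gamma> p"
  shows "commutes_along S \<Gamma> (reversepath p)"
proof -
  define a b r where "a = \<Gamma> (pathstart p)" "b = \<Gamma> (pathfinish p)" "r = reversepath p"
  have P: "path p" "path_image p \<subseteq> S"
    using p by (auto simp: commutes_along_def)
  then have S: "pathstart p \<in> S" "pathfinish p \<in> S" by auto
  note abr = a_b_r_def P S path_image_join
  have hp: "homotopic_paths S (p +++ b) (a +++ p)"
    using p by (simp add: commutes_along_def abr)
  have lin: "homotopic_paths S (r +++ p) (linepath (pathfinish p) (pathfinish p))"
    and rin: "homotopic_paths S (p +++ r) (linepath (pathstart p) (pathstart p))"
    using P homotopic_paths_linv[of p S] homotopic_paths_rinv[of p S] by (simp_all add: abr)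
  have "homotopic_paths S (r +++ a) ((r +++ a) +++ linepath (pathstart p) (pathstart p))"
    by (rule homotopic_paths_sym[OF homotopic_paths_rid'])  (simp_all add: abr)
  also have "homotopic_paths S \<dots> ((r +++ a) +++ (p +++ r))"
    by (intro homotopic_paths_join homotopic_paths_sym[OF rin]) (simp_all add: abr)
  also have "homotopic_paths S \<dots> (((r +++ a) +++ p) +++ r)"
    by (rule homotopic_paths_assoc) (simp_all add: abr)
  also have "homotopic_paths S \<dots> ((r +++ (a +++ p)) +++ r)"
    by (intro homotopic_paths_join homotopic_paths_sym[OF homotopic_paths_assoc]) (simp_all add: abr)
  also have "homotopic_paths S \<dots> ((r +++ (p +++ b)) +++ r)"
    by (intro homotopic_paths_join homotopic_paths_sym[OF hp]) (simp_all add: abr)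
  also have "homotopic_paths S \<dots> (((r +++ p) +++ b) +++ r)"
    by (intro homotopic_paths_join homotopic_paths_assoc) (simp_all add: abr)
  also have "homotopic_paths S \<dots> ((linepath (pathfinish p) (pathfinish p) +++ b) +++ r)"
    by (intro homotopic_paths_join lin) (simp_all add: abr)
  also have "homotopic_paths S \<dots> (b +++ r)"
    by (intro homotopic_paths_join homotopic_paths_lid') (simp_all add: abr)
  finally show ?thesis
    using P by (auto simp: commutes_along_def a_b_r_def)
qed

lemma commutes_along_cancel_right:
  assumes pq: "commutes_along S \<Gamma> (p +++ q)" and q: "commutes_along S \<Gamma> q"
    and P: "path p" "path_image p \<subseteq> S" "pathfinish p = pathstart q"
  shows "commutes_along S \<Gamma> p"
proof (rule commutes_along_homotopic)
  have Q: "path q" "path_image q \<subseteq> S"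
    using q by (auto simp: commutes_along_def)
  show "commutes_along S \<Gamma> ((p +++ q) +++ reversepath q)"
    by (intro commutes_along_join commutes_along_reversepath assms) simp
  have "homotopic_paths S ((p +++ q) +++ reversepath q) (p +++ (q +++ reversepath q))"
    by (rule homotopic_paths_sym[OF homotopic_paths_assoc]) (use P Q in auto)
  also have "homotopic_paths S \<dots> (p +++ linepath (pathfinish p) (pathfinish p))"
    using homotopic_paths_rinv[of q S] P Q by (intro homotopic_paths_join) auto
  also have "homotopic_paths S \<dots> p"
    by (rule homotopic_paths_rid') (use P in auto)
  finally show "homotopic_paths S ((p +++ q) +++ reversepath q) p" .
qed

lemma commutes_along_cancel_left:
  assumes pq: "commutes_along S \<Gamma> (p +++ q)" and p: "commutes_along S \<Gamma> p"
    and Q: "path q" "path_image q \<subseteq> S" "pathfinish p = pathstart q"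
  shows "commutes_along S \<Gamma> q"
proof (rule commutes_along_homotopic)
  have P: "path p" "path_image p \<subseteq> S"
    using p by (auto simp: commutes_along_def)
  show "commutes_along S \<Gamma> (reversepath p +++ (p +++ q))"
    by (intro commutes_along_join commutes_along_reversepath assms) simp
  have "homotopic_paths S (reversepath p +++ (p +++ q)) ((reversepath p +++ p) +++ q)"
    by (rule homotopic_paths_assoc) (use P Q in auto)
  also have "homotopic_paths S \<dots> (linepath (pathstart q) (pathstart q) +++ q)"
    using homotopic_paths_linv[of p S] P Q by (intro homotopic_paths_join) auto
  also have "homotopic_paths S \<dots> q"
    by (rule homotopic_paths_lid') (use Q in auto)
  finally show "homotopic_paths S (reversepath p +++ (p +++ q)) q" .
qed

end

text \<open>
  The unit square is convex, so the two ways around it are linked by a straight-line homotopy.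
\<close>
lemma homotopic_paths_square:
  fixes K :: "real \<times> real \<Rightarrow> 'a::real_normed_vector"
  assumes K: "continuous_on ({0..1} \<times> {0..1}) K" and KS: "K ` ({0..1} \<times> {0..1}) \<subseteq> S"
  shows "homotopic_paths S ((\<lambda>t. K (0, t)) +++ (\<lambda>t. K (t, 1))) ((\<lambda>t. K (t, 0)) +++ (\<lambda>t. K (1, t)))"
proof -
  define Q where "Q = {0..1::real} \<times> {0..1::real}"
  have Qc: "convex Q" unfolding Q_def by (intro convex_Times) auto
  have seg: "path_image (linepath u v) \<subseteq> Q" if "u \<in> Q" "v \<in> Q" for u v
    using closed_segment_subset[OF that Qc] by simp
  have corner: "(0,0) \<in> Q" "(0,1) \<in> Q" "(1,0) \<in> Q" "(1,1) \<in> Q"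
    by (auto simp: Q_def)
  define l r where "l = linepath (0,0) (0,1) +++ linepath (0,1) (1::real,1::real)"
    and "r = linepath (0,0) (1,0) +++ linepath (1,0) (1::real,1::real)"
  have lr: "path l" "path r" "pathstart r = pathstart l" "pathfinish r = pathfinish l"
       "path_image l \<subseteq> Q" "path_image r \<subseteq> Q"
    using seg corner by (auto simp: l_def r_def path_image_join simp del: path_image_linepath)
  have "homotopic_paths Q l r"
  proof (rule homotopic_paths_linear)
    fix t :: real assume "t \<in> {0..1}"
    then have "l t \<in> Q" "r t \<in> Q" using lr by (auto simp: path_image_def)
    then show "closed_segment (l t) (r t) \<subseteq> Q"
      by (rule closed_segment_subset[OF _ _ Qc])
  qed (use lr in auto)
  then have "homotopic_paths S (K \<circ> l) (K \<circ> r)"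
    by (rule homotopic_paths_continuous_image) (use K KS in \<open>auto simp: Q_def\<close>)
  moreover have "K \<circ> l = (\<lambda>t. K (0, t)) +++ (\<lambda>t. K (t, 1))"
    by (auto simp: fun_eq_iff l_def joinpaths_def linepath_def algebra_simps)
  moreover have "K \<circ> r = (\<lambda>t. K (t, 0)) +++ (\<lambda>t. K (1, t))"
    by (auto simp: fun_eq_iff r_def joinpaths_def linepath_def algebra_simps)
  ultimately show ?thesis by simp
qed

section \<open>Pushing paths along with moving simple roots\<close>

text \<open>
  The modulus of \<open>q\<close> at \<open>p\<close> is the modulus of the leading coefficient times the product of the distances
  from \<open>p\<close> to the roots. This gives the continuity of roots without complex analysis.
\<close>
lemma poly_root_near:
  fixes q :: "complex poly"
  assumes "norm (poly q p) < norm (lead_coeff q) * e ^ degree q" and "e > 0"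
  shows "\<exists>y. poly q y = 0 \<and> dist y p < e"
  using assms
proof (induction "degree q" arbitrary: q)
  case 0
  obtain c where "q = [:c:]" using 0(1) by (metis degree_eq_zeroE)
  with 0 show ?case by simp
next
  case (Suc n)
  then have "\<not> constant (poly q)"
    by (metis constant_degree nat.distinct(1))
  then obtain y where y: "poly q y = 0"
    using Fundamental_Theorem_Algebra.fundamental_theorem_of_algebra[of q] by blast
  then obtain q' where q': "q = [:-y, 1:] * q'"
    by (metis dvdE poly_eq_0_iff_dvd)
  have "q' \<noteq> 0" using Suc q' by auto
  then have deg: "degree q = Suc (degree q')"
    unfolding q' by (simp add: degree_mult_eq del: mult_pCons_left)
  have lc: "lead_coeff q = lead_coeff q'"
    unfolding q' by (simp only: lead_coeff_mult) simp
  show ?case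
  proof (cases "dist y p < e")
    case True
    with y show ?thesis by auto
  next
    case False
    then have "e * norm (poly q' p) \<le> norm (poly q p)"
      by (simp add: q' norm_mult dist_norm norm_minus_commute mult_right_mono flip: left_diff_distrib)
    also have "\<dots> < e * (norm (lead_coeff q') * e ^ degree q')"
      using Suc.prems deg lc by (simp add: mult_ac)
    finally have "norm (poly q' p) < norm (lead_coeff q') * e ^ degree q'"
      using \<open>e > 0\<close> by simp
    then obtain z where "poly q' z = 0" "dist z p < e"
      using Suc.hyps(1)[of q'] Suc.hyps(2) \<open>e > 0\<close> deg by auto
    then show ?thesis by (auto simp: q')
  qed
qed

lemma finite_positive_lower_bound:
  fixes A :: "real set"
  assumes "finite A" "\<And>a. a \<in> A \<Longrightarrow> a > 0"
  shows "\<exists>r>0. \<forall>a\<in>A. r \<le> a"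
  by (rule exI[of _ "Min (insert 1 A)"]) (use assms in auto)

text \<open>
  For \<open>s\<close> near \<open>s0\<close>, each of the \<open>d\<close> disjoint discs around the roots at \<open>s0\<close> contains a root,
  and there are at most \<open>d\<close> roots, so each disc contains exactly one. The graph of the resulting root function
  is closed in a compact cylinder, which makes the function continuous. The factor \<open>8\<close> leaves
  room for the supports of the bump functions in the next lemma.
\<close>
lemma simple_roots_track:
  fixes Q :: "real \<Rightarrow> complex poly"
  assumes cont: "continuous_on ({0..1} \<times> UNIV) (\<lambda>(s, y). poly (Q s) y)"
    and deg: "\<And>s. s \<in> {0..1} \<Longrightarrow> degree (Q s) = d"
    and lead: "\<And>s. s \<in> {0..1} \<Longrightarrow> lead_coeff (Q s) = c" and "c \<noteq> 0"
    and s0: "s0 \<in> {0..1}" and simple: "card {y. poly (Q s0) y = 0} = d"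
    and R: "\<And>y. poly (Q s0) y = 0 \<Longrightarrow> norm y < R"
  obtains \<eta> r \<rho> where "\<eta> > 0" "r > 0"
    "\<And>s. s \<in> {0..1} \<Longrightarrow> \<bar>s - s0\<bar> \<le> \<eta> \<Longrightarrow>
      {y. poly (Q s) y = 0} = (\<lambda>p. \<rho> p s) ` {y. poly (Q s0) y = 0}"
    "\<And>s p. s \<in> {0..1} \<Longrightarrow> \<bar>s - s0\<bar> \<le> \<eta> \<Longrightarrow> poly (Q s0) p = 0 \<Longrightarrow> dist (\<rho> p s) p < r"
    "\<And>p. poly (Q s0) p = 0 \<Longrightarrow> continuous_on ({0..1} \<inter> cball s0 \<eta>) (\<rho> p)"
    "\<And>p p'. poly (Q s0) p = 0 \<Longrightarrow> poly (Q s0) p' = 0 \<Longrightarrow> p \<noteq> p' \<Longrightarrow> 8 * r \<le> dist p p'"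
    "\<And>p. poly (Q s0) p = 0 \<Longrightarrow> norm p + 8 * r \<le> R"
proof -
  define Z where "Z = {y. poly (Q s0) y = 0}"
  have nz: "Q s \<noteq> 0" if "s \<in> {0..1}" for s
    using lead[OF that] \<open>c \<noteq> 0\<close> by auto
  have fin: "finite {y. poly (Q s) y = 0}" if "s \<in> {0..1}" for s
    using nz[OF that] by (rule poly_roots_finite)
  have finZ: "finite Z" using fin[OF s0] by (simp add: Z_def)
  obtain r8 where r8: "r8 > 0" "\<And>p p'. p \<in> Z \<Longrightarrow> p' \<in> Z \<Longrightarrow> p \<noteq> p' \<Longrightarrow> r8 \<le> dist p p'"
      "\<And>p. p \<in> Z \<Longrightarrow> r8 \<le> R - norm p"
  proof -
    let ?A = "(\<lambda>(p, p'). dist p p') ` ((Z \<times> Z) - Id) \<union> (\<lambda>p. R - norm p) ` Z"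
    have "\<exists>r>0. \<forall>a\<in>?A. r \<le> a"
      using finZ R by (intro finite_positive_lower_bound) (auto simp: Z_def)
    then obtain r where "r > 0" "\<And>a. a \<in> ?A \<Longrightarrow> r \<le> a" by blast
    then show ?thesis
      by (intro that[of r]) force+
  qed
  define r where "r = r8 / 8"
  have r: "r > 0" using r8 by (simp add: r_def)
  have sep: "8 * r \<le> dist p p'" if "p \<in> Z" "p' \<in> Z" "p \<noteq> p'" for p p'
    using r8(2)[OF that] by (simp add: r_def)
  have "\<exists>\<eta>>0. \<forall>s\<in>{0..1}. \<bar>s - s0\<bar> \<le> \<eta> \<longrightarrow> norm (poly (Q s) p) < norm c * r ^ d"
    if "p \<in> Z" for p
  proof -
    have "continuous_on {0..1} (\<lambda>s::real. (s, p))"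
      by (intro continuous_intros)
    from continuous_on_compose2[OF cont this] have "continuous_on {0..1} (\<lambda>s. poly (Q s) p)"
      by auto
    moreover have "norm c * r ^ d > 0" using r \<open>c \<noteq> 0\<close> by simp
    ultimately obtain \<eta> where "\<eta> > 0"
      "\<And>s. s \<in> {0..1} \<Longrightarrow> dist s s0 < \<eta> \<Longrightarrow> dist (poly (Q s) p) (poly (Q s0) p) < norm c * r ^ d"
      using s0 unfolding continuous_on_iff by metis
    then show ?thesis using that
      by (intro exI[of _ "\<eta> / 2"]) (auto simp: Z_def dist_norm)
  qed
  then obtain h where h: "\<And>p. p \<in> Z \<Longrightarrow> h p > 0"
    "\<And>p s. p \<in> Z \<Longrightarrow> s \<in> {0..1} \<Longrightarrow> \<bar>s - s0\<bar> \<le> h p \<Longrightarrow> norm (poly (Q s) p) < norm c * r ^ d"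
    by metis
  obtain \<eta> where \<eta>: "\<eta> > 0" "\<And>p. p \<in> Z \<Longrightarrow> \<eta> \<le> h p"
    using finite_positive_lower_bound[of "h ` Z"] finZ h(1) by auto
  define U where "U = {0..1} \<inter> cball s0 \<eta>"
  have U: "s \<in> U \<longleftrightarrow> s \<in> {0..1} \<and> \<bar>s - s0\<bar> \<le> \<eta>" for s
    by (auto simp: U_def dist_real_def abs_minus_commute)
  have "\<exists>y. poly (Q s) y = 0 \<and> dist y p < r" if "p \<in> Z" "s \<in> U" for p s
  proof (rule poly_root_near)
    show "norm (poly (Q s) p) < norm (lead_coeff (Q s)) * r ^ degree (Q s)"
      using h(2)[of p s] \<eta>(2)[of p] that deg[of s] lead[of s] by (simp add: U)
  qed (rule r)
  then obtain \<rho> where \<rho>: "\<And>p s. p \<in> Z \<Longrightarrow> s \<in> U \<Longrightarrow> poly (Q s) (\<rho> p s) = 0"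
     "\<And>p s. p \<in> Z \<Longrightarrow> s \<in> U \<Longrightarrow> dist (\<rho> p s) p < r"
    by metis
  have far: "dist p p' < 8 * r" if "dist y p \<le> r" "dist y p' \<le> r" for y p p' :: complex
    using that r dist_triangle3[of p p' y] by (simp add: dist_commute)
  have inj: "inj_on (\<lambda>p. \<rho> p s) Z" if "s \<in> U" for s
  proof (rule inj_onI)
    fix p p' assume "p \<in> Z" "p' \<in> Z" "\<rho> p s = \<rho> p' s"
    then show "p = p'"
      using far[of "\<rho> p s" p p'] \<rho>(2)[of p s] \<rho>(2)[of p' s] sep[of p p'] that
      by fastforce
  qed
  have all: "{y. poly (Q s) y = 0} = (\<lambda>p. \<rho> p s) ` Z" if "s \<in> U" for s
  proof (rule sym, rule card_subset_eq)
    show "finite {y. poly (Q s) y = 0}" using fin that by (simp add: U)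
    show sub: "(\<lambda>p. \<rho> p s) ` Z \<subseteq> {y. poly (Q s) y = 0}" using \<rho> that by auto
    have "card {y. poly (Q s) y = 0} \<le> degree (Q s)"
      using that nz by (intro card_poly_roots_bound) (auto simp: U)
    moreover have "card ((\<lambda>p. \<rho> p s) ` Z) = d"
      using card_image[OF inj[OF that]] simple by (simp add: Z_def)
    moreover have "card ((\<lambda>p. \<rho> p s) ` Z) \<le> card {y. poly (Q s) y = 0}"
      using sub fin that by (intro card_mono) (auto simp: U)
    ultimately show "card ((\<lambda>p. \<rho> p s) ` Z) = card {y. poly (Q s) y = 0}"
      using deg that by (simp add: U)
  qed
  have "continuous_on U (\<rho> p)" if p: "p \<in> Z" for p
  proof (rule continuous_from_closed_graph[of "cball p r"])
    show "\<rho> p \<in> U \<rightarrow> cball p r"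
      using less_imp_le[OF \<rho>(2)[OF p]] by (auto simp: dist_commute)
    have "(\<lambda>s. (s, \<rho> p s)) ` U = {x \<in> U \<times> cball p r. (\<lambda>(s, y). poly (Q s) y) x = 0}"
    proof (intro equalityI subsetI)
      fix x assume "x \<in> (\<lambda>s. (s, \<rho> p s)) ` U"
      then show "x \<in> {x \<in> U \<times> cball p r. (\<lambda>(s, y). poly (Q s) y) x = 0}"
        using \<rho>(1)[OF p] less_imp_le[OF \<rho>(2)[OF p]] by (auto simp: dist_commute)
    next
      fix x assume "x \<in> {x \<in> U \<times> cball p r. (\<lambda>(s, y). poly (Q s) y) x = 0}"
      then obtain s y where x: "x = (s, y)" "s \<in> U" "dist y p \<le> r" "poly (Q s) y = 0"
        by (auto simp: dist_commute)
      then obtain p' where p': "p' \<in> Z" "y = \<rho> p' s"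
        using all[of s] by auto
      then have "p' = p"
        using far[of y p p'] x \<rho>(2)[of p' s] sep[OF p p'(1)] by fastforce
      then show "x \<in> (\<lambda>s. (s, \<rho> p s)) ` U"
        using x p' by auto
    qed
    moreover have "closed {x \<in> U \<times> cball p r. (\<lambda>(s, y). poly (Q s) y) x = 0}"
      by (rule continuous_closed_preimage_constant)
         (auto simp: U_def intro!: closed_Times closed_Int continuous_on_subset[OF cont])
    ultimately show "closed ((\<lambda>s. (s, \<rho> p s)) ` U)" by simp
  qed simp
  then have cont_\<rho>: "continuous_on ({0..1} \<inter> cball s0 \<eta>) (\<rho> p)" if "p \<in> Z" for p
    using that by (simp add: U_def)
  have R': "norm p + 8 * r \<le> R" if "p \<in> Z" for p
    using r8(3)[OF that] by (simp add: r_def)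
  show ?thesis
  proof (rule that[of \<eta> r \<rho>])
    show "{y. poly (Q s) y = 0} = (\<lambda>p. \<rho> p s) ` {y. poly (Q s0) y = 0}"
      if "s \<in> {0..1}" "\<bar>s - s0\<bar> \<le> \<eta>" for s
      using all[unfolded U, OF conjI, OF that] by (simp only: Z_def)
    show "dist (\<rho> p s) p < r" if "s \<in> {0..1}" "\<bar>s - s0\<bar> \<le> \<eta>" "poly (Q s0) p = 0" for s p
      using \<rho>(2)[unfolded U Z_def mem_Collect_eq, OF that(3) conjI, OF that(1,2)] .
    show "continuous_on ({0..1} \<inter> cball s0 \<eta>) (\<rho> p)" if "poly (Q s0) p = 0" for p
      using cont_\<rho> that by (simp only: Z_def mem_Collect_eq)
    show "8 * r \<le> dist p p'" if "poly (Q s0) p = 0" "poly (Q s0) p' = 0" "p \<noteq> p'" for p p'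
      using sep that by (simp only: Z_def mem_Collect_eq)
    show "norm p + 8 * r \<le> R" if "poly (Q s0) p = 0" for p
      using R' that by (simp only: Z_def mem_Collect_eq)
  qed (fact \<eta>(1) r)+
qed

text \<open>
  The path \<open>\<beta>\<close> is pushed by the map \<open>y \<mapsto> y + \<Sum> (\<rho> p s - \<rho> p s1) * bump p y\<close>, where \<open>\<rho> p s\<close> is the moving root
  and \<open>bump p\<close> is a cone of height \<open>1\<close> and radius \<open>2 r\<close> around \<open>\<rho> p s1\<close>. The root moves by less
  than \<open>2 r\<close>, while the cone has slope \<open>1 / (2 r)\<close>, so only \<open>\<rho> p s1\<close> itself is mapped to \<open>\<rho> p s\<close>. Points of
  norm at least \<open>R\<close> lie outside all supports and stay fixed.
\<close>
lemma transport_near: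
  fixes Q :: "real \<Rightarrow> complex poly"
  assumes cont: "continuous_on ({0..1} \<times> UNIV) (\<lambda>(s, y). poly (Q s) y)"
    and deg: "\<And>s. s \<in> {0..1} \<Longrightarrow> degree (Q s) = d"
    and lead: "\<And>s. s \<in> {0..1} \<Longrightarrow> lead_coeff (Q s) = c" and "c \<noteq> 0"
    and s0: "s0 \<in> {0..1}" and simple: "card {y. poly (Q s0) y = 0} = d"
    and R: "\<And>y. poly (Q s0) y = 0 \<Longrightarrow> norm y < R"
  obtains \<eta> where "\<eta> > 0"
    "\<And>s1 s2 \<beta>. \<lbrakk>s1 \<in> {0..1}; s2 \<in> {0..1}; \<bar>s1 - s0\<bar> \<le> \<eta>; \<bar>s2 - s0\<bar> \<le> \<eta>; path \<beta>;
        \<And>t. t \<in> {0..1} \<Longrightarrow> poly (Q s1) (\<beta> t) \<noteq> 0\<rbrakk> \<Longrightarrow>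
      \<exists>H. continuous_on ({0..1} \<times> {0..1}) H \<and> (\<forall>t\<in>{0..1}. H (0, t) = \<beta> t) \<and>
          (\<forall>u\<in>{0..1}. \<forall>t\<in>{0..1}. poly (Q (s1 + u * (s2 - s1))) (H (u, t)) \<noteq> 0 \<and>
             (R \<le> norm (\<beta> t) \<longrightarrow> H (u, t) = \<beta> t))"
proof -
  obtain \<eta> r \<rho> where *: "\<eta> > 0" "r > 0"
    "\<And>s. s \<in> {0..1} \<Longrightarrow> \<bar>s - s0\<bar> \<le> \<eta> \<Longrightarrow>
      {y. poly (Q s) y = 0} = (\<lambda>p. \<rho> p s) ` {y. poly (Q s0) y = 0}"
    "\<And>s p. s \<in> {0..1} \<Longrightarrow> \<bar>s - s0\<bar> \<le> \<eta> \<Longrightarrow> poly (Q s0) p = 0 \<Longrightarrow> dist (\<rho> p s) p < r"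
    "\<And>p. poly (Q s0) p = 0 \<Longrightarrow> continuous_on ({0..1} \<inter> cball s0 \<eta>) (\<rho> p)"
    "\<And>p p'. poly (Q s0) p = 0 \<Longrightarrow> poly (Q s0) p' = 0 \<Longrightarrow> p \<noteq> p' \<Longrightarrow> 8 * r \<le> dist p p'"
    "\<And>p. poly (Q s0) p = 0 \<Longrightarrow> norm p + 8 * r \<le> R"
    by (rule simple_roots_track[of Q d c s0 R]; (rule that; assumption | rule assms; assumption))
  define Z where "Z = {y. poly (Q s0) y = 0}"
  have finZ: "finite Z"
    using lead[OF s0] \<open>c \<noteq> 0\<close> by (auto simp: Z_def intro: poly_roots_finite)
  define U where "U = {0..1} \<inter> cball s0 \<eta>"
  have U: "s \<in> U \<longleftrightarrow> s \<in> {0..1} \<and> \<bar>s - s0\<bar> \<le> \<eta>" for s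
    by (auto simp: U_def dist_real_def abs_minus_commute)
  have convU: "convex U" unfolding U_def by (intro convex_Int) auto
  have roots: "{y. poly (Q s) y = 0} = (\<lambda>p. \<rho> p s) ` Z" if "s \<in> U" for s
    using *(3) that by (simp add: U Z_def)
  have near: "dist (\<rho> p s) p < r" if "s \<in> U" "p \<in> Z" for s p
    using *(4) that by (simp add: U Z_def)
  have sep: "8 * r \<le> dist p p'" if "p \<in> Z" "p' \<in> Z" "p \<noteq> p'" for p p'
    using *(6) that by (simp add: Z_def)
  have move: "norm (\<rho> p s - \<rho> p s') < 2 * r" if "p \<in> Z" "s \<in> U" "s' \<in> U" for p s s'
    using near[of s p] near[of s' p] that dist_triangle2[of "\<rho> p s" "\<rho> p s'" p]
    by (simp add: dist_norm[symmetric])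
  have apart: "6 * r < norm (\<rho> p s - \<rho> p' s')"
    if "p \<in> Z" "p' \<in> Z" "s \<in> U" "s' \<in> U" "p \<noteq> p'" for p p' s s'
    using near[of s p] near[of s' p'] sep[of p p'] that dist_triangle[of p p' "\<rho> p s"]
      dist_triangle[of "\<rho> p s" p' "\<rho> p' s'"]
    by (simp add: dist_norm[symmetric] dist_commute)
  have "\<exists>H. continuous_on ({0..1} \<times> {0..1}) H \<and> (\<forall>t\<in>{0..1}. H (0, t) = \<beta> t) \<and>
          (\<forall>u\<in>{0..1}. \<forall>t\<in>{0..1}. poly (Q (s1 + u * (s2 - s1))) (H (u, t)) \<noteq> 0 \<and>
             (R \<le> norm (\<beta> t) \<longrightarrow> H (u, t) = \<beta> t))"
    if s1: "s1 \<in> U" and s2: "s2 \<in> U" and "path \<beta>"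
      and avoid: "\<And>t. t \<in> {0..1} \<Longrightarrow> poly (Q s1) (\<beta> t) \<noteq> 0" for s1 s2 \<beta>
  proof -
    define \<sigma> where "\<sigma> = (\<lambda>u. s1 + u * (s2 - s1))"
    define bump where "bump = (\<lambda>p y. max 0 (1 - norm (y - \<rho> p s1) / (2 * r)))"
    define push where
      "push = (\<lambda>u y. y + (\<Sum>p\<in>Z. (\<rho> p (\<sigma> u) - \<rho> p s1) * of_real (bump p y)))"
    have \<sigma>: "\<sigma> u \<in> U" if "u \<in> {0..1}" for u
    proof -
      have "\<sigma> u = (1 - u) *\<^sub>R s1 + u *\<^sub>R s2" by (simp add: \<sigma>_def algebra_simps)
      then show ?thesis using convexD_alt[OF convU s1 s2, of u] that by simp
    qed
    have bump0: "bump p y = 0" if "2 * r \<le> norm (y - \<rho> p s1)" for p y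
      using that \<open>r > 0\<close> by (simp add: bump_def)
    have push_id: "push u y = y" if "\<And>p. p \<in> Z \<Longrightarrow> 2 * r \<le> norm (y - \<rho> p s1)" for u y
      using that by (simp add: push_def bump0)
    have push_one: "push u y = y + (\<rho> p (\<sigma> u) - \<rho> p s1) * of_real (1 - norm (y - \<rho> p s1) / (2 * r))"
      if p: "p \<in> Z" and y: "norm (y - \<rho> p s1) < 2 * r" for u y p
    proof -
      have "bump p' y = 0" if "p' \<in> Z" "p' \<noteq> p" for p'
      proof (rule bump0)
        show "2 * r \<le> norm (y - \<rho> p' s1)"
          using apart[OF p that(1) s1 s1] that y \<open>r > 0\<close>
            norm_triangle_ineq[of "y - \<rho> p' s1" "\<rho> p s1 - y"]
          by (simp add: norm_minus_commute)
      qed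
      then have "(\<Sum>p\<in>Z. (\<rho> p (\<sigma> u) - \<rho> p s1) * of_real (bump p y)) =
          (\<Sum>p\<in>{p}. (\<rho> p (\<sigma> u) - \<rho> p s1) * of_real (bump p y))"
        using finZ p by (intro sum.mono_neutral_right) auto
      moreover have "bump p y = 1 - norm (y - \<rho> p s1) / (2 * r)"
        using y \<open>r > 0\<close> by (simp add: bump_def)
      ultimately show ?thesis by (simp add: push_def)
    qed
    have ne: "poly (Q (\<sigma> u)) (push u y) \<noteq> 0" if u: "u \<in> {0..1}" and y: "poly (Q s1) y \<noteq> 0" for u y
    proof
      assume "poly (Q (\<sigma> u)) (push u y) = 0"
      then obtain p' where p': "p' \<in> Z" "push u y = \<rho> p' (\<sigma> u)"
        using roots[OF \<sigma>[OF u]] by auto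
      show False
      proof (cases "\<exists>p\<in>Z. norm (y - \<rho> p s1) < 2 * r")
        case False
        then have "push u y = y" by (intro push_id) (auto simp: not_less)
        then have "norm (y - \<rho> p' s1) < 2 * r"
          using move[OF p'(1) \<sigma>[OF u] s1] p' by simp
        then show False using False p' by auto
      next
        case True
        then obtain p where p: "p \<in> Z" "norm (y - \<rho> p s1) < 2 * r" by auto
        define \<delta> where "\<delta> = \<rho> p (\<sigma> u) - \<rho> p s1"
        define k where "k = norm (y - \<rho> p s1) / (2 * r)"
        have k: "0 \<le> k" "k < 1" "norm (y - \<rho> p s1) = 2 * r * k"
          using p \<open>r > 0\<close> by (auto simp: k_def)
        have \<delta>: "norm \<delta> < 2 * r" using move[OF p(1) \<sigma>[OF u] s1] by (simp add: \<delta>_def)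
        have eq: "push u y = y + \<delta> * of_real (1 - k)"
          using push_one[OF p] by (simp add: \<delta>_def k_def)
        show False
        proof (cases "p' = p")
          case True
          then have "y - \<rho> p s1 = \<delta> * of_real k"
            using eq p' by (simp add: \<delta>_def algebra_simps)
          then have "2 * r * k = norm \<delta> * k"
            using k by (metis abs_of_nonneg norm_mult norm_of_real)
          then have "k = 0" using \<delta> by auto
          then have "y = \<rho> p s1" using k by simp
          then have "poly (Q s1) y = 0" using roots[OF s1] p by auto
          then show False using y by simp
        next
          case False
          have "norm (push u y - \<rho> p s1) \<le> norm (y - \<rho> p s1) + norm (\<delta> * of_real (1 - k))"
            unfolding eq by (metis add_diff_eq add.commute diff_add_eq norm_triangle_ineq)
          also have "\<dots> = 2 * r * k + norm \<delta> * (1 - k)"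
            using k by (simp only: norm_mult norm_of_real)
          also have "\<dots> \<le> 2 * r * k + 2 * r * (1 - k)"
            using k \<delta> by (intro add_left_mono mult_right_mono) auto
          finally have "norm (\<rho> p' (\<sigma> u) - \<rho> p s1) \<le> 2 * r"
            using p' by (simp add: algebra_simps)
          then show False
            using apart[OF p'(1) p(1) \<sigma>[OF u] s1 False] \<open>r > 0\<close> by simp
        qed
      qed
    qed
    have start: "push 0 y = y" for y
      by (simp add: push_def \<sigma>_def)
    have fixed: "push u y = y" if "u \<in> {0..1}" "R \<le> norm y" for u y
    proof (rule push_id)
      fix p assume p: "p \<in> Z"
      have "norm (\<rho> p s1) \<le> norm p + r"
        using near[OF s1 p] norm_triangle_ineq[of p "\<rho> p s1 - p"] by (simp add: dist_norm)
      then show "2 * r \<le> norm (y - \<rho> p s1)"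
        using *(7)[of p] p that \<open>r > 0\<close> norm_triangle_ineq2[of y "\<rho> p s1"] by (simp add: Z_def)
    qed
    have c\<rho>: "continuous_on ({0..1} \<times> {0..1}) (\<lambda>x. \<rho> p (\<sigma> (fst x)))" if "p \<in> Z" for p
    proof (rule continuous_on_compose2[of U "\<rho> p"])
      show "continuous_on U (\<rho> p)" using *(5) that by (simp add: U_def Z_def)
      show "continuous_on ({0..1} \<times> {0..1}) (\<lambda>x. \<sigma> (fst x))"
        unfolding \<sigma>_def by (intro continuous_intros)
    qed (use \<sigma> in auto)
    have c\<beta>: "continuous_on ({0..1} \<times> {0..1}) (\<lambda>x. \<beta> (snd x))"
      using \<open>path \<beta>\<close> unfolding path_def
      by (rule continuous_on_compose2) (auto intro: continuous_intros)
    have "continuous_on ({0..1} \<times> {0..1}) (\<lambda>x. push (fst x) (\<beta> (snd x)))"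
      unfolding push_def bump_def using \<open>r > 0\<close>
      by (intro continuous_intros c\<rho> c\<beta>) auto
    then show ?thesis
      using ne start fixed avoid
      by (intro exI[of _ "\<lambda>x. push (fst x) (\<beta> (snd x))"]) (auto simp: \<sigma>_def)
  qed
  then show ?thesis
    using \<open>\<eta> > 0\<close> by (intro that[of \<eta>]) (auto simp: U)
qed

section \<open>Centrality of the rotation loops\<close>

lemma nonzero_nearby:
  fixes f :: "'a::metric_space \<times> 'b::metric_space \<Rightarrow> 'c::real_normed_vector"
  assumes T: "compact T" and C: "compact C" and f: "continuous_on (T \<times> C) f"
    and t0: "t0 \<in> T" and ne: "\<And>c. c \<in> C \<Longrightarrow> f (t0, c) \<noteq> 0"
  shows "\<exists>e>0. \<forall>t\<in>T. \<forall>c\<in>C. dist t t0 < e \<longrightarrow> f (t, c) \<noteq> 0"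
proof (cases "C = {}")
  case True
  then show ?thesis by (intro exI[of _ 1]) auto
next
  case False
  have "continuous_on C (\<lambda>c. (t0, c))" by (intro continuous_intros)
  from continuous_on_compose2[OF f this] t0
  have "continuous_on C (\<lambda>c. norm (f (t0, c)))" by (intro continuous_on_norm) auto
  then obtain c0 where c0: "c0 \<in> C" "\<And>c. c \<in> C \<Longrightarrow> norm (f (t0, c0)) \<le> norm (f (t0, c))"
    using continuous_attains_inf[OF C False] by metis
  then have "norm (f (t0, c0)) > 0" using ne by simp
  moreover have "uniformly_continuous_on (T \<times> C) f"
    by (intro compact_uniformly_continuous f compact_Times T C)
  ultimately obtain e where e: "e > 0"
    "\<And>p q. p \<in> T \<times> C \<Longrightarrow> q \<in> T \<times> C \<Longrightarrow> dist p q < e \<Longrightarrow> dist (f p) (f q) < norm (f (t0, c0))"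
    unfolding uniformly_continuous_on_def by metis
  have "f (t, c) \<noteq> 0" if "t \<in> T" "c \<in> C" "dist t t0 < e" for t c
  proof -
    have "dist (f (t, c)) (f (t0, c)) < norm (f (t0, c0))"
      using that t0 by (intro e(2)) (auto simp: dist_Pair_Pair)
    also have "\<dots> \<le> norm (f (t0, c))" using c0 that by simp
    finally show ?thesis by auto
  qed
  then show ?thesis using e by blast
qed

text \<open>
  The points \<open>x1\<close> to be avoided lie on finitely many segments that start at \<open>0\<close>, hence in a null set.
\<close>
lemma generic_ray:
  fixes x0 :: complex
  assumes "finite B" "e > 0"
  obtains x1 where "dist x1 x0 < e" "x1 \<noteq> 0" "\<And>s::real. s \<ge> 1 \<Longrightarrow> of_real s * x1 \<notin> B"
proof -
  define N where "N = (\<Union>b\<in>insert 0 B. closed_segment 0 b)"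
  have "negligible (closed_segment 0 b)" for b :: complex
    by (subst negligible_convex_interior) (auto simp: interior_closed_segment_ge2)
  then have "negligible N"
    using assms unfolding N_def by (intro negligible_Union) auto
  then have "\<not> ball x0 e \<subseteq> N"
    using \<open>e > 0\<close> by (metis ball_eq_empty negligible_subset not_le open_ball open_not_negligible)
  then obtain x1 where x1: "dist x1 x0 < e" "x1 \<notin> N"
    by (auto simp: subset_iff dist_commute)
  show ?thesis
  proof (rule that[OF x1(1)])
    show "x1 \<noteq> 0" using x1(2) by (auto simp: N_def)
    show "of_real s * x1 \<notin> B" if "s \<ge> 1" for s :: real
    proof
      assume B: "of_real s * x1 \<in> B"
      have "x1 = (1 - 1 / s) *\<^sub>R 0 + (1 / s) *\<^sub>R (of_real s * x1)"
        using that by (simp add: scaleR_conv_of_real)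
      then have "x1 \<in> closed_segment 0 (of_real s * x1)"
        using that unfolding in_segment by (intro exI[of _ "1 / s"]) auto
      then show False using x1(2) B by (auto simp: N_def)
    qed
  qed
qed

text \<open>
  \<open>F\<close> is the homogenised equation in coordinates \<open>(x, y, z)\<close> with the affine plane at \<open>z = 1\<close>,
  and \<open>Q x z\<close> is its restriction to a vertical line as a polynomial in \<open>y\<close>. The bound \<open>nonzero_far\<close>
  is homogeneous, so it serves all values of \<open>z\<close> between \<open>1\<close> and the line at infinity.
\<close>
locale transverse_curve =
  fixes F :: "complex \<Rightarrow> complex \<Rightarrow> complex \<Rightarrow> complex"
    and Q :: "complex \<Rightarrow> complex \<Rightarrow> complex poly" and d :: nat and c :: complex and M :: real
  assumes cont: "continuous_on UNIV (\<lambda>(x, y, z). F x y z)"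
    and homogeneous: "F (l * x) (l * y) (l * z) = l ^ d * F x y z"
    and poly_Q: "poly (Q x z) y = F x y z"
    and degree_Q: "degree (Q x z) = d" and lead_Q: "lead_coeff (Q x z) = c" and c: "c \<noteq> 0"
    and d: "d > 0"
    and M: "M > 0" and nonzero_far: "M * (norm z + norm x) < norm y \<Longrightarrow> F x y z \<noteq> 0"
    and simple_at_infinity: "x \<noteq> 0 \<Longrightarrow> card {y. F x y 0 = 0} = d"
    and finite_branch: "finite {x. card {y. F x y 1 = 0} \<noteq> d}"
begin

definition curve_compl :: "(complex \<times> complex) set" where
  "curve_compl = {(x, y). F x y 1 \<noteq> 0}"

definition far_region :: "(complex \<times> complex) set" where
  "far_region = {(x, y). M * (1 + norm x) < norm y}"

text \<open>The points whose orbit under the diagonal circle action misses the curve.\<close>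
definition rot_region :: "(complex \<times> complex) set" where
  "rot_region = {(x, y). \<forall>l. norm l = 1 \<longrightarrow> (l * x, l * y) \<in> curve_compl}"

definition orbit :: "complex \<times> complex \<Rightarrow> real \<Rightarrow> complex \<times> complex" where
  "orbit w t = (cis (2 * pi * t) * fst w, cis (2 * pi * t) * snd w)"

lemma continuous_F [continuous_intros]:
  assumes "continuous_on A f" "continuous_on A g" "continuous_on A h"
  shows "continuous_on A (\<lambda>a. F (f a) (g a) (h a))"
proof -
  have "continuous_on A (\<lambda>a. (f a, g a, h a))" using assms by (intro continuous_intros)
  from continuous_on_compose2[OF cont this] show ?thesis by simp
qed

lemma F_scale: "s \<noteq> 0 \<Longrightarrow> F (x / s) (y / s) (z / s) = 0 \<longleftrightarrow> F x y z = 0"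
  using homogeneous[of s "x / s" "y / s" "z / s"] by simp

lemma far_subset_rot: "far_region \<subseteq> rot_region"
  by (auto simp: far_region_def rot_region_def curve_compl_def norm_mult intro!: nonzero_far)

lemma rot_subset_compl: "rot_region \<subseteq> curve_compl"
proof
  fix w assume "w \<in> rot_region"
  then have "(1 * fst w, 1 * snd w) \<in> curve_compl"
    unfolding rot_region_def by (cases w) (metis (mono_tags, lifting) case_prodD fst_conv mem_Collect_eq norm_one snd_conv)
  then show "w \<in> curve_compl" by simp
qed

lemma far_subset_compl: "far_region \<subseteq> curve_compl" using far_subset_rot rot_subset_compl by blast

lemma orbit_loop: "w \<in> rot_region \<Longrightarrow> orbit w \<in> loops_at curve_compl w"
  by (cases w)
     (auto simp: loops_at_def path_def path_image_def pathstart_def pathfinish_def orbit_def rot_region_def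
       intro!: continuous_intros)

lemma path_vertical: "path q \<Longrightarrow> path (\<lambda>t. (x::complex, q t :: complex))"
  unfolding path_def by (intro continuous_intros)

lemma tail_exists:
  assumes "p \<in> curve_compl"
  shows "\<exists>q. path q \<and> q 0 = snd p \<and> (fst p, q 1) \<in> far_region \<and> (\<forall>t\<in>{0..1}. F (fst p) (q t) 1 \<noteq> 0)"
proof -
  define x where "x = fst p"
  define far :: complex where "far = of_real (M * (1 + norm x) + 1)"
  have "M * (1 + norm x) \<ge> 0" using M by simp
  then have far: "(x, far) \<in> far_region" unfolding far_region_def far_def by (simp del: of_real_add of_real_mult)
  have "Q x 1 \<noteq> 0" using lead_Q[of x 1] c by auto
  then have "finite {y. F x y 1 = 0}"
    using poly_roots_finite[of "Q x 1"] by (simp add: poly_Q)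
  then have "path_connected (- {y. F x y 1 = 0})"
    by (intro path_connected_complement_countable) (auto intro: countable_finite)
  moreover have "snd p \<in> - {y. F x y 1 = 0}" "far \<in> - {y. F x y 1 = 0}"
    using assms far far_subset_compl by (auto simp: curve_compl_def x_def)
  ultimately obtain q where q: "path q" "path_image q \<subseteq> - {y. F x y 1 = 0}"
      "pathstart q = snd p" "pathfinish q = far"
    unfolding path_connected_def by metis
  show ?thesis
    using q far unfolding x_def[symmetric] by (intro exI[of _ q]) (auto simp: pathstart_def pathfinish_def path_image_def)
qed

text \<open>
  A chosen way inside the vertical line through \<open>p\<close> from \<open>p\<close> to the far region; only its second
  coordinate is recorded.
\<close>
definition tail :: "complex \<times> complex \<Rightarrow> real \<Rightarrow> complex" where
  "tail p = (SOME q. path q \<and> q 0 = snd p \<and> (fst p, q 1) \<in> far_region \<and> (\<forall>t\<in>{0..1}. F (fst p) (q t) 1 \<noteq> 0))"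

lemma tail:
  assumes "p \<in> curve_compl"
  shows "path (tail p)" "tail p 0 = snd p" "(fst p, tail p 1) \<in> far_region" "\<And>t. t \<in> {0..1} \<Longrightarrow> F (fst p) (tail p t) 1 \<noteq> 0"
  using someI_ex[OF tail_exists[OF assms]] unfolding tail_def by blast+

definition vtail :: "complex \<times> complex \<Rightarrow> real \<Rightarrow> complex \<times> complex" where
  "vtail p = (\<lambda>t. (fst p, tail p t))"

lemma vtail:
  assumes "p \<in> curve_compl"
  shows "path (vtail p)" "path_image (vtail p) \<subseteq> curve_compl" "pathstart (vtail p) = p" "pathfinish (vtail p) \<in> far_region"
  using tail[OF assms]
  by (auto simp: vtail_def path_vertical path_image_def pathstart_def pathfinish_def curve_compl_def)

text \<open>
  The circle orbit of an arbitrary point may hit the curve, hence the detour through the far region. The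
  class of the loop does not depend on the detour, which is the content of \<open>central_vertical\<close>.
\<close>
definition rotation_loop :: "complex \<times> complex \<Rightarrow> real \<Rightarrow> complex \<times> complex" where
  "rotation_loop p = (if p \<in> far_region then orbit p
     else (vtail p +++ orbit (pathfinish (vtail p))) +++ reversepath (vtail p))"

sublocale loop_family curve_compl rotation_loop
proof
  fix p assume p: "p \<in> curve_compl"
  define q where "q = pathfinish (vtail p)"
  have "q \<in> rot_region" using vtail[OF p] far_subset_rot by (auto simp: q_def)
  then have "orbit q \<in> loops_at curve_compl q" by (rule orbit_loop)
  then show "rotation_loop p \<in> loops_at curve_compl p"
    using vtail[OF p] orbit_loop[of p] far_subset_rot
    by (auto simp: rotation_loop_def loops_at_def path_image_join simp flip: q_def)
qed

abbreviation central :: "(real \<Rightarrow> complex \<times> complex) \<Rightarrow> bool" where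
  "central \<equiv> commutes_along curve_compl rotation_loop"

text \<open>
  Rotating the path through a full turn sweeps out a square with the path on two opposite sides
  and the two rotation loops on the others.
\<close>
lemma central_in_rot_region:
  assumes p: "path p" "path_image p \<subseteq> rot_region" and ends: "pathstart p \<in> far_region" "pathfinish p \<in> far_region"
  shows "central p"
proof -
  define K where "K = (\<lambda>(u, t). (cis (2 * pi * u) * fst (p t), cis (2 * pi * u) * snd (p t)))"
  have "continuous_on ({0..1} \<times> {0..1::real}) (\<lambda>x. p (snd x))"
    using p(1) unfolding path_def
    by (rule continuous_on_compose2) (auto intro: continuous_intros)
  then have "continuous_on ({0..1} \<times> {0..1}) K"
    unfolding K_def case_prod_unfold by (intro continuous_intros)
  moreover have "K ` ({0..1} \<times> {0..1}) \<subseteq> curve_compl"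
    using p(2) by (force simp: K_def path_image_def rot_region_def)
  ultimately have "homotopic_paths curve_compl ((\<lambda>t. K (0, t)) +++ (\<lambda>t. K (t, 1))) ((\<lambda>t. K (t, 0)) +++ (\<lambda>t. K (1, t)))"
    using homotopic_paths_square[of K curve_compl] by simp
  moreover have "(\<lambda>t. K (0, t)) = p" "(\<lambda>t. K (1, t)) = p"
      "(\<lambda>t. K (t, 0)) = rotation_loop (pathstart p)" "(\<lambda>t. K (t, 1)) = rotation_loop (pathfinish p)"
    using ends by (auto simp: K_def rotation_loop_def orbit_def fun_eq_iff pathstart_def pathfinish_def)
  ultimately show ?thesis
    using p rot_subset_compl by (auto simp: commutes_along_def)
qed

text \<open>
  Centrality is invariant under free homotopies whose ends stay in the far region, because the
  ends trace central paths.
\<close>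
lemma central_slide:
  assumes K: "continuous_on ({0..1} \<times> {0..1::real}) K"
    and KY: "\<And>u t. u \<in> {0..1} \<Longrightarrow> t \<in> {0..1} \<Longrightarrow> K (u, t) \<in> curve_compl"
    and ends: "\<And>u. u \<in> {0..1::real} \<Longrightarrow> K (u, 0) \<in> far_region \<and> K (u, 1) \<in> far_region"
    and central: "central (\<lambda>t. K (1, t))"
  shows "central (\<lambda>t. K (0, t))"
proof -
  have sub: "continuous_on {0..1} (\<lambda>t. K (f t, g t))"
    if "continuous_on {0..1} f" "continuous_on {0..1} g" "f ` {0..1} \<subseteq> {0..1}" "g ` {0..1} \<subseteq> {0..1}"
    for f g :: "real \<Rightarrow> real"
    by (rule continuous_on_compose2[OF K]) (use that in \<open>auto intro!: continuous_intros\<close>)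
  have paths: "path (\<lambda>t. K (0, t))" "path (\<lambda>t. K (t, 0))" "path (\<lambda>t. K (t, 1))"
    unfolding path_def by (auto intro!: sub continuous_intros)
  have "K (u, 0) \<in> rot_region \<and> K (u, 1) \<in> rot_region" if "u \<in> {0..1}" for u
    using ends[OF that] far_subset_rot by blast
  then have top: "central (\<lambda>t. K (t, 1))" and bottom: "central (\<lambda>t. K (t, 0))"
    using paths ends
    by (auto intro!: central_in_rot_region simp: path_image_def image_subset_iff pathstart_def pathfinish_def simp del: split_paired_All)
  have "central ((\<lambda>t. K (t, 0)) +++ (\<lambda>t. K (1, t)))"
    by (intro commutes_along_join bottom central) (simp add: pathstart_def pathfinish_def)
  moreover have "homotopic_paths curve_compl ((\<lambda>t. K (0, t)) +++ (\<lambda>t. K (t, 1))) ((\<lambda>t. K (t, 0)) +++ (\<lambda>t. K (1, t)))"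
    using homotopic_paths_square[of K curve_compl] K KY by (auto simp: image_subset_iff)
  ultimately have "central ((\<lambda>t. K (0, t)) +++ (\<lambda>t. K (t, 1)))"
    using commutes_along_homotopic homotopic_paths_sym by blast
  then show ?thesis
    by (rule commutes_along_cancel_right[OF _ top])
       (use paths KY in \<open>auto simp: path_image_def pathstart_def pathfinish_def\<close>)
qed

text \<open>
  By homogeneity, \<open>F x y s = 0\<close> describes the line over \<open>x / s\<close> rescaled by \<open>s\<close>. Thus \<open>s \<in> {0<..1}\<close> runs through
  the ray from \<open>x\<close> to infinity, and \<open>s = 0\<close> is the line at infinity.
\<close>
lemma card_roots_ray:
  assumes "x \<noteq> 0" and generic: "\<And>s::real. s \<ge> 1 \<Longrightarrow> card {y. F (of_real s * x) y 1 = 0} = d"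
    and s: "s \<in> {0..1}"
  shows "card {y. F x y (of_real s) = 0} = d"
proof (cases "s = 0")
  case True
  then show ?thesis using simple_at_infinity[OF \<open>x \<noteq> 0\<close>] by simp
next
  case False
  have "{y. F x y (of_real s) = 0} = (\<lambda>y. of_real s * y) ` {y. F (of_real (1 / s) * x) y 1 = 0}"
  proof (intro equalityI subsetI)
    fix y assume "y \<in> {y. F x y (of_real s) = 0}"
    then show "y \<in> (\<lambda>y. of_real s * y) ` {y. F (of_real (1 / s) * x) y 1 = 0}"
      using F_scale[of "of_real s" x y "of_real s"] False
      by (intro image_eqI[of _ _ "y / of_real s"]) auto
  next
    fix y assume "y \<in> (\<lambda>y. of_real s * y) ` {y. F (of_real (1 / s) * x) y 1 = 0}"
    then show "y \<in> {y. F x y (of_real s) = 0}"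
      using F_scale[of "of_real s" x y "of_real s"] False by auto
  qed
  moreover have "inj (\<lambda>y. complex_of_real s * y)"
    using False by (auto simp: inj_on_def)
  ultimately have "card {y. F x y (of_real s) = 0} = card {y. F (of_real (1 / s) * x) y 1 = 0}"
    by (metis card_image inj_on_subset subset_UNIV)
  then show ?thesis
    using generic[of "1 / s"] s False by simp
qed

lemma scaled_in_far_region:
  assumes "s > 0" "s \<le> 1" "M * (1 + norm x) < norm y"
  shows "(x / of_real s, y / of_real s) \<in> far_region"
proof -
  have "M * (s + norm x) \<le> M * (1 + norm x)" using M assms by simp
  then have "M * (s + norm x) < norm y" using assms by simp
  then have "M * (s + norm x) / s < norm y / s"
    using assms(1) by (rule divide_strict_right_mono)
  moreover have "M * (s + norm x) / s = M * (1 + norm x / s)"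
    using assms(1) by (simp add: add_divide_distrib distrib_left)
  ultimately show ?thesis
    using assms(1) by (simp add: far_region_def norm_divide)
qed

text \<open>
  The predicate \<open>A s\<close> in the proof says that all paths in the line over \<open>x / s\<close> with ends
  far away are central. Transport shows that it is locally constant in \<open>s\<close>.
  It is declared true at \<open>s = 0\<close>, where no line of the affine plane remains. This is
  justified for small \<open>s\<close> by letting the path run to infinity: the limit avoids the zeros of the
  homogeneous form \<open>F x y 0\<close>, together with its orbit, so by compactness the path lies in the
  rotation invariant region shortly before the limit.
\<close>
lemma central_vertical_generic:
  assumes "x \<noteq> 0" and generic: "\<And>s::real. s \<ge> 1 \<Longrightarrow> card {y. F (of_real s * x) y 1 = 0} = d"
    and q: "path q" "\<And>t. t \<in> {0..1} \<Longrightarrow> F x (q t) 1 \<noteq> 0"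
    and ends: "(x, q 0) \<in> far_region" "(x, q 1) \<in> far_region"
  shows "central (\<lambda>t. (x, q t))"
proof -
  define R where "R = min (norm (q 0)) (norm (q 1))"
  have R: "M * (1 + norm x) < R" using ends by (simp add: R_def far_region_def)
  define A where "A = (\<lambda>s::real. s = 0 \<or> (\<forall>\<beta>. path \<beta> \<and> (\<forall>t\<in>{0..1}. F x (\<beta> t) (of_real s) \<noteq> 0) \<and>
      R \<le> norm (\<beta> 0) \<and> R \<le> norm (\<beta> 1) \<longrightarrow> central (\<lambda>t. (x / of_real s, \<beta> t / of_real s))))"
  have local: "\<exists>\<eta>>0. \<forall>s1\<in>{0..1}. \<forall>s2\<in>{0..1}. \<bar>s1 - s0\<bar> \<le> \<eta> \<longrightarrow> \<bar>s2 - s0\<bar> \<le> \<eta> \<longrightarrow> A s2 \<longrightarrow> A s1"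
    if s0: "s0 \<in> {0..1}" for s0
  proof -
    have roots_bound: "norm y < R" if "poly (Q x (of_real s0)) y = 0" for y
    proof -
      have "norm y \<le> M * (s0 + norm x)"
        using that nonzero_far[of "of_real s0" x y] s0 unfolding poly_Q by (cases "norm y \<le> M * (s0 + norm x)") auto
      also have "\<dots> \<le> M * (1 + norm x)" using s0 M by simp
      finally show ?thesis using R by simp
    qed
    have card_s0: "card {y. poly (Q x (of_real s0)) y = 0} = d"
      using card_roots_ray[OF \<open>x \<noteq> 0\<close> generic s0] by (simp add: poly_Q)
    have cont_Q: "continuous_on ({0..1} \<times> UNIV) (\<lambda>(s, y). poly (Q x (complex_of_real s)) y)"
      unfolding poly_Q case_prod_unfold by (intro continuous_intros)
    obtain \<eta> where \<eta>: "\<eta> > 0"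
      "\<And>s1 s2 \<beta>. \<lbrakk>s1 \<in> {0..1}; s2 \<in> {0..1}; \<bar>s1 - s0\<bar> \<le> \<eta>; \<bar>s2 - s0\<bar> \<le> \<eta>; path \<beta>;
        \<And>t. t \<in> {0..1} \<Longrightarrow> poly (Q x (of_real s1)) (\<beta> t) \<noteq> 0\<rbrakk> \<Longrightarrow>
      \<exists>H. continuous_on ({0..1} \<times> {0..1}) H \<and> (\<forall>t\<in>{0..1}. H (0, t) = \<beta> t) \<and>
          (\<forall>u\<in>{0..1}. \<forall>t\<in>{0..1}. poly (Q x (of_real (s1 + u * (s2 - s1)))) (H (u, t)) \<noteq> 0 \<and>
             (R \<le> norm (\<beta> t) \<longrightarrow> H (u, t) = \<beta> t))"
      by (rule transport_near[of "\<lambda>s. Q x (of_real s)" d c s0 R];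
          (rule cont_Q degree_Q lead_Q c s0 card_s0 | (rule roots_bound, assumption)
            | (rule that, assumption, blast)))
    have "A s1" if s: "s1 \<in> {0..1}" "s2 \<in> {0..1}" "\<bar>s1 - s0\<bar> \<le> \<eta>" "\<bar>s2 - s0\<bar> \<le> \<eta>" and A2: "A s2" for s1 s2
    proof (cases "s1 = 0")
      case False
      have "central (\<lambda>t. (x / of_real s1, \<beta> t / of_real s1))"
        if \<beta>: "path \<beta>" "\<And>t. t \<in> {0..1} \<Longrightarrow> F x (\<beta> t) (of_real s1) \<noteq> 0" "R \<le> norm (\<beta> 0)" "R \<le> norm (\<beta> 1)" for \<beta>
      proof -
        have "\<exists>H. continuous_on ({0..1} \<times> {0..1}) H \<and> (\<forall>t\<in>{0..1}. H (0, t) = \<beta> t) \<and>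
            (\<forall>u\<in>{0..1}. \<forall>t\<in>{0..1}. poly (Q x (of_real (s1 + u * (s2 - s1)))) (H (u, t)) \<noteq> 0 \<and>
             (R \<le> norm (\<beta> t) \<longrightarrow> H (u, t) = \<beta> t))"
          using \<beta> by (intro \<eta>(2) s) (auto simp: poly_Q)
        then obtain H where H: "continuous_on ({0..1} \<times> {0..1}) H" "\<And>t. t \<in> {0..1} \<Longrightarrow> H (0, t) = \<beta> t"
            "\<And>u t. u \<in> {0..1} \<Longrightarrow> t \<in> {0..1} \<Longrightarrow> F x (H (u, t)) (of_real (s1 + u * (s2 - s1))) \<noteq> 0"
            "\<And>u t. u \<in> {0..1} \<Longrightarrow> t \<in> {0..1} \<Longrightarrow> R \<le> norm (\<beta> t) \<Longrightarrow> H (u, t) = \<beta> t"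
          unfolding poly_Q by blast
        define \<sigma> where "\<sigma> = (\<lambda>u. s1 + u * (s2 - s1))"
        have \<sigma>1: "\<sigma> u \<le> 1" if "u \<in> {0..1}" for u
        proof -
          have "\<sigma> u = (1 - u) * s1 + u * s2" by (simp add: \<sigma>_def algebra_simps)
          also have "\<dots> \<le> (1 - u) * 1 + u * 1" using that s by (intro add_mono mult_left_mono) auto
          finally show ?thesis by simp
        qed
        have \<sigma>0: "\<sigma> u > 0" if "u \<in> {0..1}" "u < 1 \<or> s2 \<noteq> 0" for u
        proof -
          have "\<sigma> u = (1 - u) * s1 + u * s2" by (simp add: \<sigma>_def algebra_simps)
          moreover have "(1 - u) * s1 \<ge> 0" "u * s2 \<ge> 0" using that s by auto
          moreover have "(1 - u) * s1 > 0 \<or> u * s2 > 0"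
            using that s False by (cases "u = 1") auto
          ultimately show ?thesis by linarith
        qed
        have endsH: "H (u, 0) = \<beta> 0" "H (u, 1) = \<beta> 1" if "u \<in> {0..1}" for u
          using H(4) that \<beta> by auto
        \<comment> \<open>it suffices to reach, somewhere along the way, a path that is already central\<close>
        have reduce: "central (\<lambda>t. (x / of_real s1, \<beta> t / of_real s1))"
          if u0: "u0 \<in> {0..1}" "u0 < 1 \<or> s2 \<noteq> 0"
            and C: "central (\<lambda>t. (x / of_real (\<sigma> u0), H (u0, t) / of_real (\<sigma> u0)))" for u0
        proof -
          define K where
            "K = (\<lambda>(u, t). (x / of_real (\<sigma> (u * u0)), H (u * u0, t) / complex_of_real (\<sigma> (u * u0))))"
          have uu: "u * u0 \<in> {0..1}" "u * u0 < 1 \<or> s2 \<noteq> 0" if "u \<in> {0..1}" for u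
            using that u0 mult_mono[of u 1 u0 1] mult_right_mono[of u 1 u0] by auto
          have "central (\<lambda>t. K (0, t))"
          proof (rule central_slide)
            have "continuous_on ({0..1} \<times> {0..1}) (\<lambda>x. H (fst x * u0, snd x))"
              by (rule continuous_on_compose2[OF H(1)]) (use uu in \<open>auto intro!: continuous_intros\<close>)
            moreover have "complex_of_real (\<sigma> (u * u0)) \<noteq> 0" if "u \<in> {0..1}" for u
              using \<sigma>0 uu[OF that] by fastforce
            ultimately show "continuous_on ({0..1} \<times> {0..1}) K"
              unfolding K_def case_prod_unfold
              by (intro continuous_intros) (auto simp: \<sigma>_def intro!: continuous_intros)
            show "K (u, t) \<in> curve_compl" if "u \<in> {0..1}" "t \<in> {0..1}" for u t
            proof -
              have "F x (H (u * u0, t)) (of_real (\<sigma> (u * u0))) \<noteq> 0"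
                using H(3)[OF uu(1)[OF that(1)] that(2)] by (simp only: \<sigma>_def not_False_eq_True)
              then show ?thesis
                using \<sigma>0[OF uu[OF that(1)]]
                  F_scale[of "of_real (\<sigma> (u * u0))" x "H (u * u0, t)" "of_real (\<sigma> (u * u0))"]
                by (simp add: K_def curve_compl_def)
            qed
            show "K (u, 0) \<in> far_region \<and> K (u, 1) \<in> far_region" if "u \<in> {0..1}" for u
              using endsH[OF uu(1)[OF that]] \<sigma>0[OF uu[OF that]] \<sigma>1[OF uu(1)[OF that]] \<beta> R
              by (auto simp: K_def intro!: scaled_in_far_region)
            show "central (\<lambda>t. K (1, t))" using C by (simp add: K_def)
          qed
          then show ?thesis
            by (rule commutes_along_cong) (use H(2) in \<open>simp add: K_def \<sigma>_def\<close>)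
        qed
        have path_H: "path (\<lambda>t. H (u, t))" if "u \<in> {0..1}" for u
          unfolding path_def
          by (rule continuous_on_compose2[OF H(1)]) (use that in \<open>auto intro!: continuous_intros\<close>)
        show ?thesis
        proof (cases "s2 = 0")
          case False
          have "central (\<lambda>t. (x / of_real (\<sigma> 1), H (1, t) / of_real (\<sigma> 1)))"
            using A2 False path_H[of 1] H(3)[of 1] endsH[of 1] \<beta>(3,4) unfolding A_def by (simp add: \<sigma>_def)
          then show ?thesis using reduce[of 1] False by simp
        next
          case True
          define G where "G = (\<lambda>z::real \<times> complex \<times> real. F (fst (snd z) * x)
              (fst (snd z) * H (fst z, snd (snd z))) (complex_of_real (\<sigma> (fst z))))"
          have "continuous_on ({0..1} \<times> (sphere 0 1 \<times> {0..1})) G"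
          proof -
            have "continuous_on ({0..1} \<times> (sphere 0 1 \<times> {0..1}))
                (\<lambda>z::real \<times> complex \<times> real. H (fst z, snd (snd z)))"
              by (rule continuous_on_compose2[OF H(1)]) (auto intro!: continuous_intros)
            then show ?thesis
              unfolding \<sigma>_def G_def by (intro continuous_intros)
          qed
          moreover have "G (1, z) \<noteq> 0" if "z \<in> sphere 0 1 \<times> {0..1}" for z
            using homogeneous[of "fst z" x "H (1, snd z)" 0] H(3)[of 1 "snd z"] that True
            by (auto simp: \<sigma>_def G_def)
          ultimately have "\<exists>e>0. \<forall>u\<in>{0..1}. \<forall>z\<in>sphere 0 1 \<times> {0..1}. dist u 1 < e \<longrightarrow> G (u, z) \<noteq> 0"
            by (intro nonzero_nearby compact_Times) auto
          then obtain e where e: "e > 0" "\<And>u l t. u \<in> {0..1} \<Longrightarrow> l \<in> sphere 0 1 \<Longrightarrow> t \<in> {0..1} \<Longrightarrow>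
              dist u 1 < e \<Longrightarrow> F (l * x) (l * H (u, t)) (of_real (\<sigma> u)) \<noteq> 0"
            by (fastforce simp: G_def)
          define u0 where "u0 = max 0 (1 - e / 2)"
          have u0: "u0 \<in> {0..1}" "u0 < 1" "dist u0 1 < e"
            using \<open>e > 0\<close> by (auto simp: u0_def dist_real_def max_def)
          have "central (\<lambda>t. (x / of_real (\<sigma> u0), H (u0, t) / of_real (\<sigma> u0)))"
          proof (rule central_in_rot_region)
            have "\<sigma> u0 \<noteq> 0" using \<sigma>0[of u0] u0 by simp
            then show "path (\<lambda>t. (x / of_real (\<sigma> u0), H (u0, t) / complex_of_real (\<sigma> u0)))"
              using path_H[OF u0(1)] unfolding path_def by (intro continuous_intros) auto
            show "path_image (\<lambda>t. (x / of_real (\<sigma> u0), H (u0, t) / complex_of_real (\<sigma> u0))) \<subseteq> rot_region"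
              using e(2)[OF u0(1) _ _ u0(3)] F_scale[of "of_real (\<sigma> u0)" _ _ "of_real (\<sigma> u0)"] \<open>\<sigma> u0 \<noteq> 0\<close>
              by (auto simp: path_image_def rot_region_def curve_compl_def)
          qed (use endsH[OF u0(1)] \<sigma>0[of u0] \<sigma>1[of u0] u0 \<beta> R in
                 \<open>auto simp: pathstart_def pathfinish_def intro!: scaled_in_far_region\<close>)
          then show ?thesis using reduce[of u0] u0 by simp
        qed
      qed
      then show ?thesis by (simp add: A_def)
    qed (simp add: A_def)
    then show ?thesis using \<open>\<eta> > 0\<close> by blast
  qed
  define P where "P = (\<lambda>a b. 0 \<le> a \<and> b \<le> 1 \<longrightarrow> (A a \<longleftrightarrow> A b))"
  have "P 0 1"
  proof (rule Bolzano)
    show "P a c" if "P a b" "P b c" "a \<le> b" "b \<le> c" for a b c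
      using that by (auto simp: P_def)
    fix s0 :: real assume s0: "0 \<le> s0" "s0 \<le> 1"
    then have "s0 \<in> {0..1}" by simp
    from local[OF this] obtain \<eta> where \<eta>: "\<eta> > 0"
      "\<And>s1 s2. s1 \<in> {0..1} \<Longrightarrow> s2 \<in> {0..1} \<Longrightarrow> \<bar>s1 - s0\<bar> \<le> \<eta> \<Longrightarrow> \<bar>s2 - s0\<bar> \<le> \<eta> \<Longrightarrow> A s2 \<Longrightarrow> A s1"
      by blast
    have "P a b" if "a \<le> s0" "s0 \<le> b" "b - a < \<eta>" for a b
      unfolding P_def using \<eta>(2)[of a b] \<eta>(2)[of b a] that by auto
    then show "\<exists>\<eta>>0. \<forall>a b. a \<le> s0 \<and> s0 \<le> b \<and> b - a < \<eta> \<longrightarrow> P a b"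
      using \<open>\<eta> > 0\<close> by blast
  qed simp
  then have "A 1" by (simp add: P_def A_def)
  then show ?thesis using q by (simp add: A_def R_def)
qed

text \<open>
  A compact path misses the curve also after a small horizontal translation, and the translation can be chosen
  so that the ray from its new position avoids the branch points.
\<close>
lemma central_vertical_far_ends:
  assumes q: "path q" "\<And>t. t \<in> {0..1} \<Longrightarrow> F x0 (q t) 1 \<noteq> 0"
    and ends: "(x0, q 0) \<in> far_region" "(x0, q 1) \<in> far_region"
  shows "central (\<lambda>t. (x0, q t))"
proof -
  define g where "g = min (norm (q 0)) (norm (q 1)) - M * (1 + norm x0)"
  have g: "g > 0" using ends by (simp add: g_def far_region_def)
  have q2: "continuous_on (A \<times> {0..1}) (\<lambda>z. q (snd z))" for A :: "'z::topological_space set"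
    using q(1) unfolding path_def
    by (rule continuous_on_compose2) (auto intro: continuous_intros)
  have "\<exists>e>0. \<forall>x\<in>cball x0 1. \<forall>t\<in>{0..1}. dist x x0 < e \<longrightarrow> (\<lambda>z. F (fst z) (q (snd z)) 1) (x, t) \<noteq> 0"
    using q(2) by (intro nonzero_nearby continuous_intros q2) auto
  then obtain e1 where e1: "e1 > 0"
      "\<And>x t. x \<in> cball x0 1 \<Longrightarrow> t \<in> {0..1} \<Longrightarrow> dist x x0 < e1 \<Longrightarrow> F x (q t) 1 \<noteq> 0"
    by fastforce
  define e where "e = min 1 (min e1 (g / M))"
  have e: "e > 0" "e \<le> 1" "e \<le> e1" "e \<le> g / M"
    using e1(1) g M by (auto simp: e_def)
  then have Me: "M * e \<le> g" using M by (simp add: pos_le_divide_eq mult.commute)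
  obtain x1 where x1: "dist x1 x0 < e" "x1 \<noteq> 0"
      "\<And>s::real. s \<ge> 1 \<Longrightarrow> of_real s * x1 \<notin> {x. card {y. F x y 1 = 0} \<noteq> d}"
    using generic_ray[OF finite_branch e(1)] by metis
  have near: "F x (q t) 1 \<noteq> 0" if "dist x x0 < e" "t \<in> {0..1}" for x t
    using e1(2)[of x t] e that by (simp add: dist_commute)
  have nearV: "(x, q 0) \<in> far_region \<and> (x, q 1) \<in> far_region" if "dist x x0 < e" for x
  proof -
    have "norm x < norm x0 + e"
      using that norm_triangle_ineq2[of x x0] by (simp add: dist_norm)
    then have "M * (1 + norm x) < M * (1 + norm x0 + e)"
      using M by simp
    also have "\<dots> \<le> M * (1 + norm x0) + g"
      using Me by (simp add: algebra_simps)
    finally show ?thesis by (simp add: g_def far_region_def)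
  qed
  define K where "K = (\<lambda>(u, t). (x0 + of_real u * (x1 - x0), q t))"
  have close: "dist (x0 + of_real u * (x1 - x0)) x0 < e" if "u \<in> {0..1}" for u :: real
  proof -
    have "dist (x0 + of_real u * (x1 - x0)) x0 = u * dist x1 x0"
      using that by (simp add: dist_norm norm_mult)
    also have "\<dots> \<le> 1 * dist x1 x0" using that by (intro mult_right_mono) auto
    finally show ?thesis using x1(1) by simp
  qed
  have "central (\<lambda>t. K (0, t))"
  proof (rule central_slide)
    show "continuous_on ({0..1} \<times> {0..1}) K"
      unfolding K_def case_prod_unfold by (intro continuous_intros q2)
    show "K (u, t) \<in> curve_compl" if "u \<in> {0..1}" "t \<in> {0..1}" for u t
      using near[OF close] that by (simp add: K_def curve_compl_def)
    show "K (u, 0) \<in> far_region \<and> K (u, 1) \<in> far_region" if "u \<in> {0..1}" for u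
      using nearV[OF close] that by (simp add: K_def)
    have "central (\<lambda>t. (x1, q t))"
      using x1 near[of x1] nearV[of x1] by (intro central_vertical_generic q(1)) auto
    then show "central (\<lambda>t. K (1, t))"
      by (simp add: K_def)
  qed
  then show ?thesis by (simp add: K_def)
qed

text \<open>
  Outside the far region, the rotation loop at \<open>p\<close> is by definition the conjugate of an orbit by this path.
\<close>
lemma central_vtail:
  assumes p: "p \<in> curve_compl"
  shows "central (vtail p)"
proof (cases "p \<in> far_region")
  case True
  then show ?thesis
    using central_vertical_far_ends[of "tail p" "fst p"] tail[OF p]
    by (simp add: vtail_def)
next
  case False
  define q where "q = pathfinish (vtail p)"
  note v = vtail[OF p]
  have q: "q \<in> far_region" using v by (simp add: q_def)
  then have orb: "orbit q \<in> loops_at curve_compl q" using orbit_loop far_subset_rot by blast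
  then have o: "path (orbit q)" "path_image (orbit q) \<subseteq> curve_compl" "pathstart (orbit q) = q" "pathfinish (orbit q) = q"
    by (auto simp: loops_at_def)
  have "homotopic_paths curve_compl (rotation_loop p +++ vtail p)
      ((vtail p +++ orbit q) +++ (reversepath (vtail p) +++ vtail p))"
    using False v o unfolding rotation_loop_def q_def[symmetric]
    by (simp, intro homotopic_paths_sym[OF homotopic_paths_assoc]) (auto simp: path_image_join q_def)
  also have "homotopic_paths curve_compl \<dots> ((vtail p +++ orbit q) +++ linepath q q)"
    using homotopic_paths_linv[of "vtail p" curve_compl] v o
    by (intro homotopic_paths_join) (auto simp: path_image_join q_def)
  also have "homotopic_paths curve_compl \<dots> (vtail p +++ orbit q)"
    using v o by (intro homotopic_paths_rid') (auto simp: path_image_join q_def)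
  finally have "homotopic_paths curve_compl (vtail p +++ orbit q) (rotation_loop p +++ vtail p)"
    by (rule homotopic_paths_sym)
  moreover have "rotation_loop q = orbit q" using q by (simp add: rotation_loop_def)
  ultimately show ?thesis
    using v by (simp add: commutes_along_def q_def)
qed

text \<open>
  Completing the path by the chosen ways from its ends to the far region gives a path with far ends.
\<close>
lemma central_vertical:
  assumes q: "path q" "\<And>t. t \<in> {0..1} \<Longrightarrow> F x (q t) 1 \<noteq> 0"
  shows "central (\<lambda>t. (x, q t))"
proof -
  define a b where "a = (x, q 0)" and "b = (x, q 1)"
  have ab: "a \<in> curve_compl" "b \<in> curve_compl" using q by (auto simp: a_def b_def curve_compl_def)
  note ta = tail[OF ab(1)] and tb = tail[OF ab(2)]
  define r where "r = reversepath (tail a) +++ (q +++ tail b)"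
  have "central (\<lambda>t. (x, r t))"
  proof (rule central_vertical_far_ends)
    have joinable: "pathfinish q = pathstart (tail b)" "pathstart q = pathstart (tail a)"
      using ta tb by (auto simp: pathstart_def pathfinish_def a_def b_def)
    then show "path r"
      using ta tb q unfolding r_def by auto
    have "path_image r \<subseteq> {y. F x y 1 \<noteq> 0}"
      using joinable ta(4) tb(4) q
      by (auto simp: r_def path_image_join) (auto simp: path_image_def a_def b_def)
    then show "F x (r t) 1 \<noteq> 0" if "t \<in> {0..1}" for t
      using that by (auto simp: path_image_def image_subset_iff)
    show "(x, r 0) \<in> far_region" "(x, r 1) \<in> far_region"
      using ta(3) tb(3) by (auto simp: r_def joinpaths_def reversepath_def a_def b_def)
  qed
  moreover have "(\<lambda>t. (x, r t)) = reversepath (vtail a) +++ ((\<lambda>t. (x, q t)) +++ vtail b)"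
    by (simp add: r_def vtail_def joinpaths_def reversepath_def fun_eq_iff a_def b_def)
  ultimately have whole: "central (reversepath (vtail a) +++ ((\<lambda>t. (x, q t)) +++ vtail b))"
    by simp
  have pv: "path (\<lambda>t. (x, q t))" "path_image (\<lambda>t. (x, q t)) \<subseteq> curve_compl"
      "pathstart (\<lambda>t. (x, q t)) = a" "pathfinish (\<lambda>t. (x, q t)) = b"
    using q path_vertical[OF q(1)]
    by (simp_all add: path_image_def image_subset_iff curve_compl_def pathstart_def pathfinish_def a_def b_def)
  have "central ((\<lambda>t. (x, q t)) +++ vtail b)"
  proof (rule commutes_along_cancel_left[OF whole])
    show "central (reversepath (vtail a))"
      by (intro commutes_along_reversepath central_vtail ab)
  qed (use pv vtail[OF ab(1)] vtail[OF ab(2)] in \<open>simp_all add: path_image_join\<close>)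
  from commutes_along_cancel_right[OF this central_vtail[OF ab(2)]] show ?thesis
    using vtail[OF ab(2)] pv by simp
qed

text \<open>
  The way from \<open>\<alpha> t0\<close> to the far region can be translated along with \<open>\<alpha> u\<close> for \<open>u\<close> near \<open>t0\<close>.
  The square swept out in this manner has \<open>\<alpha>\<close> on one side, vertical paths on two sides and a path in the
  far region on the last one. As centrality is stable under joining, a subdivision argument finishes the proof.
\<close>
lemma central_all:
  assumes \<alpha>: "path \<alpha>" "path_image \<alpha> \<subseteq> curve_compl"
  shows "central \<alpha>"
proof -
  have \<alpha>c: "continuous_on {0..1} \<alpha>" using \<alpha> by (simp add: path_def)
  have \<alpha>_in: "\<alpha> t \<in> curve_compl" if "t \<in> {0..1}" for t using \<alpha>(2) that by (auto simp: path_image_def)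
  define P where "P = (\<lambda>a b. 0 \<le> a \<and> a \<le> b \<and> b \<le> 1 \<longrightarrow> central (subpath a b \<alpha>))"
  have "P 0 1"
  proof (rule Bolzano)
    fix a b c assume P: "P a b" "P b c" "a \<le> b" "b \<le> c"
    show "P a c"
      unfolding P_def
    proof
      assume r: "0 \<le> a \<and> a \<le> c \<and> c \<le> 1"
      have "central (subpath a b \<alpha> +++ subpath b c \<alpha>)"
        using P r by (intro commutes_along_join) (auto simp: P_def)
      moreover have "homotopic_paths curve_compl (subpath a b \<alpha> +++ subpath b c \<alpha>) (subpath a c \<alpha>)"
        using P r by (intro homotopic_join_subpaths \<alpha>) auto
      ultimately show "central (subpath a c \<alpha>)"
        by (rule commutes_along_homotopic)
    qed
  next
    fix t0 :: real assume t0: "0 \<le> t0" "t0 \<le> 1"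
    define p where "p = \<alpha> t0"
    have pY: "p \<in> curve_compl" using \<alpha>_in t0 by (simp add: p_def)
    note tp = tail[OF pY]
    define k where "k = (\<lambda>u \<tau>. tail p \<tau> + of_real (1 - \<tau>) * (snd (\<alpha> u) - snd p))"
    have ck: "continuous_on ({0..1} \<times> {0..1}) (\<lambda>z. k (fst z) (snd z))"
        "continuous_on ({0..1} \<times> {0..1::real}) (\<lambda>z. fst (\<alpha> (fst z)))"
    proof -
      have "continuous_on ({0..1} \<times> {0..1::real}) (\<lambda>z. \<alpha> (fst z))"
        by (rule continuous_on_compose2[OF \<alpha>c]) (auto intro: continuous_intros)
      moreover have "continuous_on ({0..1::real} \<times> {0..1}) (\<lambda>z. tail p (snd z))"
        using tp(1) unfolding path_def
        by (rule continuous_on_compose2) (auto intro: continuous_intros)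
      ultimately show "continuous_on ({0..1} \<times> {0..1}) (\<lambda>z. k (fst z) (snd z))"
          "continuous_on ({0..1} \<times> {0..1::real}) (\<lambda>z. fst (\<alpha> (fst z)))"
        unfolding k_def by (auto intro!: continuous_intros)
    qed
    have "\<exists>e>0. \<forall>u\<in>{0..1}. \<forall>\<tau>\<in>{0..1}. dist u t0 < e \<longrightarrow> (\<lambda>z. F (fst (\<alpha> (fst z))) (k (fst z) (snd z)) 1) (u, \<tau>) \<noteq> 0"
      using t0 tp(4) by (intro nonzero_nearby continuous_intros ck) (auto simp: k_def p_def)
    then obtain e1 where e1: "e1 > 0" "\<And>u \<tau>. u \<in> {0..1} \<Longrightarrow> \<tau> \<in> {0..1} \<Longrightarrow> dist u t0 < e1 \<Longrightarrow>
        F (fst (\<alpha> u)) (k u \<tau>) 1 \<noteq> 0"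
      by fastforce
    have kV: "k u 1 = tail p 1" for u by (simp add: k_def)
    have "\<exists>e>0. \<forall>u\<in>{0..1}. dist u t0 < e \<longrightarrow> (fst (\<alpha> u), tail p 1) \<in> far_region"
    proof -
      have "continuous_on {0..1} (\<lambda>u. norm (fst (\<alpha> u)))"
        by (intro continuous_intros \<alpha>c)
      moreover have gap: "norm (tail p 1) / M - 1 - norm (fst p) > 0"
        using tp(3) M by (simp add: far_region_def field_simps)
      ultimately obtain e where "e > 0" "\<And>u. u \<in> {0..1} \<Longrightarrow> dist u t0 < e \<Longrightarrow>
          dist (norm (fst (\<alpha> u))) (norm (fst (\<alpha> t0))) < norm (tail p 1) / M - 1 - norm (fst p)"
        using t0 unfolding continuous_on_iff by (metis atLeastAtMost_iff)
      moreover have "(fst (\<alpha> u), tail p 1) \<in> far_region"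
        if "dist (norm (fst (\<alpha> u))) (norm (fst (\<alpha> t0))) < norm (tail p 1) / M - 1 - norm (fst p)" for u
      proof -
        have "1 + norm (fst (\<alpha> u)) < norm (tail p 1) / M"
          using that by (simp add: dist_real_def p_def)
        then show ?thesis using M by (simp add: far_region_def field_simps)
      qed
      ultimately show ?thesis by blast
    qed
    then obtain e2 where e2: "e2 > 0" "\<And>u. u \<in> {0..1} \<Longrightarrow> dist u t0 < e2 \<Longrightarrow> (fst (\<alpha> u), tail p 1) \<in> far_region"
      by blast
    have "P a b" if ab: "a \<le> t0" "t0 \<le> b" "b - a < min e1 e2" for a b
      unfolding P_def
    proof
      assume r: "0 \<le> a \<and> a \<le> b \<and> b \<le> 1"
      have near: "u \<in> {0..1} \<and> dist u t0 < e1 \<and> dist u t0 < e2" if "u \<in> {a..b}" for u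
        using that ab r by (auto simp: dist_real_def)
      \<comment> \<open>the vertical paths from the points of the short piece to the far region sweep out a square\<close>
      define K where "K = (\<lambda>(u, \<tau>). (fst (\<alpha> (a + u * (b - a))), k (a + u * (b - a)) \<tau>))"
      have range: "a + u * (b - a) \<in> {a..b}" if "u \<in> {0..1}" for u
        using that r mult_right_mono[of u 1 "b - a"] by auto
      have contK: "continuous_on ({0..1} \<times> {0..1}) K"
      proof -
        have g: "continuous_on ({0..1} \<times> {0..1}) (\<lambda>z. (a + fst z * (b - a), snd z :: real))"
          by (intro continuous_intros)
        have i: "(\<lambda>z. (a + fst z * (b - a), snd z)) ` ({0..1} \<times> {0..1}) \<subseteq> {0..1} \<times> {0..1::real}"
        proof (rule image_subsetI)
          fix z :: "real \<times> real" assume "z \<in> {0..1} \<times> {0..1}"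
          then show "(a + fst z * (b - a), snd z) \<in> {0..1} \<times> {0..1}"
            using near[OF range, of "fst z"] by (simp add: mem_Times_iff)
        qed
        show ?thesis
          using continuous_on_compose2[OF ck(1) g i] continuous_on_compose2[OF ck(2) g i]
          unfolding K_def case_prod_unfold by (simp add: continuous_on_Pair)
      qed
      have KY: "K (u, \<tau>) \<in> curve_compl" if "u \<in> {0..1}" "\<tau> \<in> {0..1}" for u \<tau>
        using e1(2) near[OF range[OF that(1)]] that by (simp add: K_def curve_compl_def)
      have "homotopic_paths curve_compl ((\<lambda>t. K (0, t)) +++ (\<lambda>t. K (t, 1))) ((\<lambda>t. K (t, 0)) +++ (\<lambda>t. K (1, t)))"
        using homotopic_paths_square[of K curve_compl] contK KY by (auto simp: image_subset_iff)
      moreover have side: "central (\<lambda>t. K (u, t))" if "u \<in> {0..1}" for u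
      proof -
        have "continuous_on {0..1} (\<lambda>\<tau>. k (a + u * (b - a)) \<tau>)"
          using tp(1) unfolding k_def path_def by (intro continuous_intros)
        then show ?thesis
          using central_vertical[of "k (a + u * (b - a))" "fst (\<alpha> (a + u * (b - a)))"]
            KY[OF that] by (simp add: K_def path_def curve_compl_def)
      qed
      have sub: "continuous_on {0..1} (\<lambda>t. K (f t, g t))"
        if "continuous_on {0..1} f" "continuous_on {0..1} g" "f ` {0..1} \<subseteq> {0..1}" "g ` {0..1} \<subseteq> {0..1}"
        for f g :: "real \<Rightarrow> real"
        by (rule continuous_on_compose2[OF contK]) (use that in \<open>auto intro!: continuous_intros\<close>)
      have top: "central (\<lambda>t. K (t, 1))"
      proof (rule central_in_rot_region)
        show "path (\<lambda>t. K (t, 1))"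
          unfolding path_def by (auto intro!: sub continuous_intros)
        have "K (u, 1) \<in> far_region" if "u \<in> {0..1}" for u
          using e2(2) near[OF range[OF that]] by (simp add: K_def kV)
        then show "path_image (\<lambda>t. K (t, 1)) \<subseteq> rot_region" "pathstart (\<lambda>t. K (t, 1)) \<in> far_region" "pathfinish (\<lambda>t. K (t, 1)) \<in> far_region"
          using far_subset_rot by (auto simp: path_image_def pathstart_def pathfinish_def)
      qed
      ultimately have "central ((\<lambda>t. K (t, 0)) +++ (\<lambda>t. K (1, t)))"
        using commutes_along_homotopic[OF commutes_along_join[OF side[of 0] top]]
        by (simp add: pathstart_def pathfinish_def)
      then have "central (\<lambda>t. K (t, 0))"
      proof (rule commutes_along_cancel_right[OF _ side])
        show "path (\<lambda>t. K (t, 0))"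
          unfolding path_def by (auto intro!: sub continuous_intros)
        show "path_image (\<lambda>t. K (t, 0)) \<subseteq> curve_compl" using KY by (auto simp: path_image_def)
      qed (auto simp: pathstart_def pathfinish_def)
      moreover have "(\<lambda>t. K (t, 0)) = subpath a b \<alpha>"
        using tp(2) by (simp add: K_def k_def subpath_def fun_eq_iff algebra_simps)
      ultimately show "central (subpath a b \<alpha>)" by simp
    qed
    then show "\<exists>e>0. \<forall>a b. a \<le> t0 \<and> t0 \<le> b \<and> b - a < e \<longrightarrow> P a b"
      using e1(1) e2(1) by (intro exI[of _ "min e1 e2"]) auto
  qed simp
  then show ?thesis by (simp add: P_def)
qed

end

section \<open>Winding number of the rotation loops\<close>

lemma winding_number_power_loop:
  assumes "a \<noteq> 0" "n > 0"
  shows "winding_number (\<lambda>t. cis (2 * pi * t) ^ n * a) 0 = of_nat n"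
proof -
  define \<gamma> where "\<gamma> = part_circlepath 0 (norm a) (Arg a) (Arg a + 2 * pi * n)"
  have \<gamma>: "(\<lambda>t. cis (2 * pi * t) ^ n * a) = \<gamma>"
  proof
    fix t :: real
    have a: "a = of_real (norm a) * cis (Arg a)"
      using rcis_cmod_Arg[of a] by (simp add: rcis_def)
    have "cis (2 * pi * t) ^ n * a = cis (real n * (2 * pi * t)) * (of_real (norm a) * cis (Arg a))"
      by (rule arg_cong2[where f = "(*)", OF Complex.DeMoivre a])
    also have "\<dots> = of_real (norm a) * cis (Arg a + t * (2 * pi * n))"
      by (simp add: cis_mult algebra_simps)
    also have "\<dots> = \<gamma> t"
      by (simp add: \<gamma>_def part_circlepath_def linepath_def cis_conv_exp algebra_simps)
    finally show "cis (2 * pi * t) ^ n * a = \<gamma> t" .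
  qed
  have 0: "0 \<notin> path_image \<gamma>"
    using assms by (auto simp: path_image_def simp flip: \<gamma>)
  have "((\<lambda>w. 1 / (w - 0)) has_contour_integral (2 * pi * \<i> * of_nat n)) \<gamma>"
  proof -
    define \<beta> where "\<beta> = Arg a + 2 * pi * n"
    have \<beta>: "Arg a < \<beta>" using \<open>n > 0\<close> by (simp add: \<beta>_def)
    have "((\<lambda>t::real. \<i>) has_integral measure lborel {Arg a..\<beta>} *\<^sub>R \<i>) {Arg a..\<beta>}"
      by (rule has_integral_const_real)
    moreover have "measure lborel {Arg a..\<beta>} *\<^sub>R \<i> = 2 * pi * \<i> * of_nat n"
      using \<beta> by (simp add: \<beta>_def scaleR_conv_of_real)
    ultimately show ?thesis
      using \<beta> assms(1) unfolding \<gamma>_def \<beta>_def[symmetric]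
      by (simp add: has_contour_integral_part_circlepath_iff)
  qed
  then show ?thesis
    using winding_number_valid_path[of \<gamma> 0] 0
    by (simp add: \<gamma> contour_integral_unique) (simp add: \<gamma>_def)
qed

context transverse_curve begin

text \<open>
  Letting \<open>z\<close> run from \<open>1\<close> to \<open>0\<close> in \<open>F\<close> deforms the image of the orbit into \<open>t \<mapsto> e\<^sup>2\<^sup>\<pi>\<^sup>i\<^sup>d\<^sup>t F x y 0\<close>, by
  homogeneity, and the deformation avoids \<open>0\<close> because \<open>w\<close> is in the far region.
\<close>
lemma winding_orbit:
  assumes "w \<in> far_region"
  shows "winding_number ((\<lambda>(x, y). F x y 1) \<circ> orbit w) 0 = of_nat d"
proof -
  obtain x y where w: "w = (x, y)" by force
  define h where "h = (\<lambda>z::real \<times> real. F (cis (2 * pi * snd z) * x) (cis (2 * pi * snd z) * y) (of_real (1 - fst z)))"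
  have ne: "F (l * x) (l * y) (of_real (1 - u)) \<noteq> 0" if "norm l = 1" "u \<in> {0..1}" for l u
  proof (rule nonzero_far)
    have "M * (norm (complex_of_real (1 - u)) + norm (l * x)) \<le> M * (1 + norm x)"
      using that M by (simp add: norm_mult del: of_real_diff)
    then show "M * (norm (complex_of_real (1 - u)) + norm (l * x)) < norm (l * y)"
      using assms that by (simp add: w far_region_def norm_mult del: of_real_diff)
  qed
  have "homotopic_loops (-{0}) ((\<lambda>(x, y). F x y 1) \<circ> orbit w) (\<lambda>t. cis (2 * pi * t) ^ d * F x y 0)"
    unfolding homotopic_loops
  proof (intro exI[of _ h] conjI ballI)
    show "continuous_on ({0..1} \<times> {0..1}) h"
      unfolding h_def by (intro continuous_intros)
    show "h \<in> {0..1} \<times> {0..1} \<rightarrow> - {0}"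
      using ne by (auto simp: h_def)
  qed (auto simp: h_def w orbit_def homogeneous[of _ x y 0, simplified] pathstart_def pathfinish_def)
  then show ?thesis
    using winding_number_homotopic_loops winding_number_power_loop[of "F x y 0" d] d ne[of 1 1]
    by simp
qed

lemma rotation_loop_nontrivial:
  assumes p: "p \<in> curve_compl"
  shows "\<not> homotopic_paths curve_compl (rotation_loop p) (linepath p p)"
proof
  define f where "f = (\<lambda>(x, y). F x y 1)"
  assume "homotopic_paths curve_compl (rotation_loop p) (linepath p p)"
  moreover have cf: "continuous_on A f" for A
    unfolding f_def case_prod_unfold by (intro continuous_intros)
  moreover have fY: "f ` curve_compl \<subseteq> -{0}" by (auto simp: f_def curve_compl_def)
  ultimately have "homotopic_paths (-{0}) (f \<circ> rotation_loop p) (f \<circ> linepath p p)"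
    by (intro homotopic_paths_continuous_image) auto
  then have "winding_number (f \<circ> rotation_loop p) 0 = winding_number (f \<circ> linepath p p) 0"
    by (rule winding_number_homotopic_paths)
  also have "f \<circ> linepath p p = linepath (f p) (f p)"
    by (auto simp: linepath_refl)
  also have "winding_number \<dots> 0 = 0"
    using p fY by (intro winding_number_trivial) auto
  finally have 0: "winding_number (f \<circ> rotation_loop p) 0 = 0" .
  show False
  proof (cases "p \<in> far_region")
    case True
    then show False
      using 0 winding_orbit[of p] d by (simp add: rotation_loop_def f_def)
  next
    case False
    define q where "q = pathfinish (vtail p)"
    note v = vtail[OF p]
    have q: "q \<in> far_region" using v by (simp add: q_def)
    then have "orbit q \<in> loops_at curve_compl q" using orbit_loop far_subset_rot by blast
    then have o: "path (orbit q)" "path_image (orbit q) \<subseteq> curve_compl" "pathstart (orbit q) = q" "pathfinish (orbit q) = q"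
      by (auto simp: loops_at_def)
    have pf: "path (f \<circ> g)" "0 \<notin> path_image (f \<circ> g)" if "path g" "path_image g \<subseteq> curve_compl" for g
      using path_continuous_image[OF that(1) cf] that(2) fY by (auto simp: path_image_compose)
    have "f \<circ> rotation_loop p = ((f \<circ> vtail p) +++ (f \<circ> orbit q)) +++ reversepath (f \<circ> vtail p)"
      using False by (simp add: rotation_loop_def q_def path_compose_join path_compose_reversepath)
    then have "winding_number (f \<circ> rotation_loop p) 0 = winding_number (f \<circ> orbit q) 0"
      using pf[OF v(1,2)] pf[OF o(1,2)] v o
      by (simp add: winding_number_join winding_number_reversepath path_image_join
            pathfinish_compose pathstart_compose q_def)
    then show False
      using 0 winding_orbit[OF q] d by (simp add: f_def)
  qed
qed

end

section \<open>The equation of the curve\<close>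

lemma rsquarefree_card_roots:
  fixes p :: "complex poly"
  assumes "rsquarefree p"
  shows "card {y. poly p y = 0} = degree p"
proof -
  have "p \<noteq> 0" using assms by (simp add: rsquarefree_def)
  have "degree p = degree (Polynomial.smult (lead_coeff p) (\<Prod>z|poly p z = 0. [:-z, 1:]))"
    using complex_poly_decompose_rsquarefree[OF assms] by simp
  also have "\<dots> = degree (\<Prod>z|poly p z = 0. [:-z, 1:])"
    using \<open>p \<noteq> 0\<close> by simp
  also have "\<dots> = (\<Sum>z|poly p z = 0. degree [:-z, 1:])"
    by (rule degree_prod_sum_eq) auto
  finally show ?thesis by simp
qed

lemma resultant_pderiv_nonzero_iff:
  fixes p :: "complex poly"
  assumes "p \<noteq> 0"
  shows "resultant p (pderiv p) \<noteq> 0 \<longleftrightarrow> rsquarefree p"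
proof -
  let ?g = "gcd p (pderiv p)"
  have g: "?g \<noteq> 0" using assms by simp
  have "degree ?g = 0 \<longleftrightarrow> (\<forall>a. poly ?g a \<noteq> 0)"
  proof
    assume "degree ?g = 0"
    then obtain c where "?g = [:c:]" by (rule degree_eq_zeroE)
    then show "\<forall>a. poly ?g a \<noteq> 0" using g by simp
  next
    assume "\<forall>a. poly ?g a \<noteq> 0"
    then show "degree ?g = 0"
      using Fundamental_Theorem_Algebra.fundamental_theorem_of_algebra[of ?g]
      by (auto simp: constant_degree)
  qed
  moreover have "poly ?g a = 0 \<longleftrightarrow> poly p a = 0 \<and> poly (pderiv p) a = 0" for a
    by (simp add: poly_eq_0_iff_dvd)
  moreover have "resultant p (pderiv p) \<noteq> 0 \<longleftrightarrow> degree ?g = 0"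
    by (simp add: resultant_0_gcd)
  ultimately show ?thesis
    by (simp add: rsquarefree_roots)
qed

text \<open>
  As the degree is constant in the family, the resultant of a member with its derivative is a
  polynomial in the parameter. It does not vanish identically as one member is squarefree.
\<close>
lemma finite_not_rsquarefree:
  fixes P :: "complex poly poly"
  assumes deg: "\<And>z. degree (map_poly (\<lambda>p. poly p z) P) = degree P"
    and pos: "degree P > 0"
    and z0: "rsquarefree (map_poly (\<lambda>p. poly p z0) P)"
  shows "finite {z. \<not> rsquarefree (map_poly (\<lambda>p. poly p z) P)}"
proof -
  define R where "R = resultant P (pderiv P)"
  have R: "poly R z = resultant (map_poly (\<lambda>p. poly p z) P) (pderiv (map_poly (\<lambda>p. poly p z) P))" for z
  proof -
    have ev: "comm_ring_hom (\<lambda>p. poly p z)" by unfold_locales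
    have "pderiv (map_poly (\<lambda>p. poly p z) P) = map_poly (\<lambda>p. poly p z) (pderiv P)"
      by (rule poly_eqI) (simp add: coeff_map_poly coeff_pderiv)
    moreover have "degree (map_poly (\<lambda>p. poly p z) (pderiv P)) = degree (pderiv P)"
      using deg[of z] calculation by (metis degree_pderiv)
    ultimately show ?thesis
      using comm_ring_hom.resultant_map_poly[OF ev deg] by (simp add: R_def)
  qed
  have nz: "map_poly (\<lambda>p. poly p z) P \<noteq> 0" for z
    using deg[of z] pos by auto
  have iff: "poly R z \<noteq> 0 \<longleftrightarrow> rsquarefree (map_poly (\<lambda>p. poly p z) P)" for z
    unfolding R by (rule resultant_pderiv_nonzero_iff[OF nz])
  then have "R \<noteq> 0" using z0 by (metis poly_0)
  then have "finite {z. poly R z = 0}" by (rule poly_roots_finite)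
  then show ?thesis
    using iff by (metis (mono_tags, lifting) Collect_cong)
qed

lemma finite_triangle: "finite {(i, j). i + j \<le> (n::nat)}"
  by (rule finite_subset[of _ "{..n} \<times> {..n}"]) auto

lemma total_degree_bound:
  assumes "coeff (coeff f j) i \<noteq> 0"
  shows "i + j \<le> total_degree f"
proof -
  define N where "N = degree f + (\<Sum>j\<le>degree f. degree (coeff f j))"
  have "i + j \<le> N" if "coeff (coeff f j) i \<noteq> 0" for i j
  proof -
    have j: "j \<le> degree f" using that by (intro le_degree) auto
    have "i \<le> degree (coeff f j)" using that by (rule le_degree)
    also have "\<dots> \<le> (\<Sum>j\<le>degree f. degree (coeff f j))"
      using j by (intro member_le_sum) auto
    finally show ?thesis using j by (simp add: N_def)
  qed
  then have "\<forall>i j. coeff (coeff f j) i \<noteq> 0 \<longrightarrow> i + j \<le> N" by blast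
  from LeastI[of "\<lambda>d. \<forall>i j. coeff (coeff f j) i \<noteq> 0 \<longrightarrow> i + j \<le> d", OF this]
  show ?thesis using assms unfolding total_degree_def by blast
qed

lemma total_degree_attained:
  assumes "total_degree f > 0"
  obtains i j where "coeff (coeff f j) i \<noteq> 0" "i + j = total_degree f"
proof -
  define n where "n = total_degree f"
  have "\<not> (\<forall>i j. coeff (coeff f j) i \<noteq> 0 \<longrightarrow> i + j \<le> n - 1)"
    using not_less_Least[of "n - 1" "\<lambda>d. \<forall>i j. coeff (coeff f j) i \<noteq> 0 \<longrightarrow> i + j \<le> d"] assms
    by (simp add: n_def total_degree_def[symmetric])
  then obtain i j where ij: "coeff (coeff f j) i \<noteq> 0" "\<not> i + j \<le> n - 1" by blast
  then have "i + j = n" using total_degree_bound[OF ij(1)] by (simp add: n_def)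
  then show ?thesis using that ij by (simp add: n_def)
qed

lemma homogenization_1: "homogenization f x y 1 = poly2 f x y"
proof -
  define N where "N = max (total_degree f) (Max ((\<lambda>j. degree (coeff f j)) ` {..degree f}) + degree f)"
  have N: "degree f \<le> N" "total_degree f \<le> N" by (auto simp: N_def)
  have deg: "degree (coeff f j) \<le> N" for j
  proof (cases "j \<le> degree f")
    case True
    then have "degree (coeff f j) \<le> Max ((\<lambda>j. degree (coeff f j)) ` {..degree f})"
      by (intro Max_ge) auto
    then show ?thesis by (simp add: N_def)
  qed (simp add: coeff_eq_0)
  have altdef: "poly p x = (\<Sum>i\<le>N. coeff p i * x ^ i)" if "degree p \<le> N"
    for p :: "'c::comm_semiring_1 poly" and x
    unfolding poly_altdef using that by (intro sum.mono_neutral_left) (auto simp: coeff_eq_0)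
  have "poly2 f x y = (\<Sum>j\<le>N. \<Sum>i\<le>N. coeff (coeff f j) i * x ^ i * y ^ j)"
    unfolding poly2_def altdef[OF N(1)]
    by (simp add: poly_sum poly_power altdef[OF deg] sum_distrib_right)
  also have "\<dots> = (\<Sum>i\<le>N. \<Sum>j\<le>N. coeff (coeff f j) i * x ^ i * y ^ j)"
    by (rule sum.swap)
  also have "\<dots> = (\<Sum>(i, j)\<in>{..N} \<times> {..N}. coeff (coeff f j) i * x ^ i * y ^ j)"
    by (rule sum.cartesian_product)
  also have "\<dots> = (\<Sum>(i, j)\<in>{(i, j). i + j \<le> total_degree f}. coeff (coeff f j) i * x ^ i * y ^ j)"
    using N(2) total_degree_bound by (intro sum.mono_neutral_right) auto
  finally show ?thesis by (simp add: homogenization_def)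
qed

lemma homogenization_scale:
  "homogenization f (l * x) (l * y) (l * z) = l ^ total_degree f * homogenization f x y z"
  unfolding homogenization_def sum_distrib_left
proof (intro sum.cong refl, clarify)
  fix i j assume "i + j \<le> total_degree f"
  then have "l ^ total_degree f = l ^ i * l ^ j * l ^ (total_degree f - (i + j))"
    by (simp flip: power_add)
  then show "coeff (coeff f j) i * (l * x) ^ i * (l * y) ^ j * (l * z) ^ (total_degree f - (i + j)) =
      l ^ total_degree f * (coeff (coeff f j) i * x ^ i * y ^ j * z ^ (total_degree f - (i + j)))"
    by (simp add: power_mult_distrib mult_ac)
qed

lemma continuous_on_homogenization:
  "continuous_on A p \<Longrightarrow> continuous_on A q \<Longrightarrow> continuous_on A r \<Longrightarrow>
    continuous_on A (\<lambda>t. homogenization f (p t) (q t) (r t))"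
  unfolding homogenization_def split_def by (intro continuous_intros)

definition partial_x :: "complex poly poly \<Rightarrow> complex \<Rightarrow> complex \<Rightarrow> complex \<Rightarrow> complex" where
  "partial_x f x y z = (\<Sum>(i, j)\<in>{(i, j). i + j \<le> total_degree f}.
     coeff (coeff f j) i * (of_nat i * x ^ (i - 1)) * y ^ j * z ^ (total_degree f - (i + j)))"

definition partial_y :: "complex poly poly \<Rightarrow> complex \<Rightarrow> complex \<Rightarrow> complex \<Rightarrow> complex" where
  "partial_y f x y z = (\<Sum>(i, j)\<in>{(i, j). i + j \<le> total_degree f}.
     coeff (coeff f j) i * x ^ i * (of_nat j * y ^ (j - 1)) * z ^ (total_degree f - (i + j)))"

definition partial_z :: "complex poly poly \<Rightarrow> complex \<Rightarrow> complex \<Rightarrow> complex \<Rightarrow> complex" where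
  "partial_z f x y z = (\<Sum>(i, j)\<in>{(i, j). i + j \<le> total_degree f}.
     coeff (coeff f j) i * x ^ i * y ^ j *
       (of_nat (total_degree f - (i + j)) * z ^ (total_degree f - (i + j) - 1)))"

lemma DERIV_homogenization:
  assumes p: "(p has_field_derivative p') (at t)" and q: "(q has_field_derivative q') (at t)"
    and r: "(r has_field_derivative r') (at t)"
  shows "((\<lambda>t. homogenization f (p t) (q t) (r t)) has_field_derivative
    (partial_x f (p t) (q t) (r t) * p' + partial_y f (p t) (q t) (r t) * q' +
     partial_z f (p t) (q t) (r t) * r')) (at t)"
  unfolding homogenization_def partial_x_def partial_y_def partial_z_def split_def
    sum_distrib_right sum.distrib[symmetric]
  by (rule DERIV_sum) (auto intro!: derivative_eq_intros p q r simp: algebra_simps)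

lemma gradient_homogenization:
  "gradient (homogenization f) (x, y, z) = (partial_x f x y z, partial_y f x y z, partial_z f x y z)"
  using DERIV_homogenization[of "\<lambda>t. t" 1 x "\<lambda>_. y" 0 "\<lambda>_. z" 0 f]
    DERIV_homogenization[of "\<lambda>_. x" 0 y "\<lambda>t. t" 1 "\<lambda>_. z" 0 f]
    DERIV_homogenization[of "\<lambda>_. x" 0 z "\<lambda>_. y" 0 "\<lambda>t. t" 1 f]
  by (auto simp: gradient_def DERIV_imp_deriv)

lemma euler_homogenization:
  "x * partial_x f x y z + y * partial_y f x y z + z * partial_z f x y z =
     of_nat (total_degree f) * homogenization f x y z"
proof (rule DERIV_unique)
  have "((\<lambda>t. homogenization f (t * x) (t * y) (t * z)) has_field_derivative
      (partial_x f (1 * x) (1 * y) (1 * z) * x + partial_y f (1 * x) (1 * y) (1 * z) * y +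
       partial_z f (1 * x) (1 * y) (1 * z) * z)) (at 1)"
    by (rule DERIV_homogenization) (auto intro!: derivative_eq_intros)
  then show "((\<lambda>t. homogenization f (t * x) (t * y) (t * z)) has_field_derivative
      (x * partial_x f x y z + y * partial_y f x y z + z * partial_z f x y z)) (at 1)"
    by (simp add: mult.commute)
  show "((\<lambda>t. homogenization f (t * x) (t * y) (t * z)) has_field_derivative
      of_nat (total_degree f) * homogenization f x y z) (at 1)"
    unfolding homogenization_scale by (auto intro!: derivative_eq_intros)
qed

lemma coeff_monom_linear_power:
  fixes a b :: "'c::comm_ring_1"
  shows "coeff (monom 1 j * [:a, b:] ^ i) k =
    (if j \<le> k \<and> k - j \<le> i then of_nat (i choose (k - j)) * b ^ (k - j) * a ^ (i - (k - j)) else 0)"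
proof (cases "j \<le> k \<and> i < k - j")
  case True
  have "degree ([:a, b:] ^ i) \<le> degree [:a, b:] * i" by (rule degree_power_le)
  also have "\<dots> \<le> 1 * i" by (intro mult_right_mono) auto
  finally have "coeff ([:a, b:] ^ i) (k - j) = 0" using True by (intro coeff_eq_0) simp
  then show ?thesis using True by (simp add: coeff_monom_mult)
qed (auto simp: coeff_monom_mult coeff_linear_poly_power)

text \<open>
  The restriction of the homogenised equation to a vertical line in the sheared coordinates
  \<open>(x + a y, y, z)\<close>.
\<close>
definition vertical_poly :: "complex poly poly \<Rightarrow> complex \<Rightarrow> complex \<Rightarrow> complex \<Rightarrow> complex poly" where
  "vertical_poly f a x z = (\<Sum>(i, j)\<in>{(i, j). i + j \<le> total_degree f}.
     Polynomial.smult (coeff (coeff f j) i * z ^ (total_degree f - (i + j))) (monom 1 j * [:x, a:] ^ i))"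

lemma poly_vertical_poly: "poly (vertical_poly f a x z) y = homogenization f (x + a * y) y z"
  unfolding vertical_poly_def homogenization_def poly_sum
  by (intro sum.cong refl) (auto simp: poly_monom mult_ac)

lemma coeff_vertical_poly:
  "coeff (vertical_poly f a x z) k = (\<Sum>(i, j)\<in>{(i, j). i + j \<le> total_degree f}.
     coeff (coeff f j) i * z ^ (total_degree f - (i + j)) * coeff (monom 1 j * [:x, a:] ^ i) k)"
  unfolding vertical_poly_def coeff_sum by (intro sum.cong refl) auto

lemma coeff_vertical_poly_top:
  "coeff (vertical_poly f a x z) (total_degree f) = homogenization f a 1 0"
  unfolding coeff_vertical_poly homogenization_def
  by (intro sum.cong refl) (auto simp: coeff_monom_linear_power power_0_left)

lemma degree_vertical_poly:
  assumes "homogenization f a 1 0 \<noteq> 0"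
  shows "degree (vertical_poly f a x z) = total_degree f"
proof (rule antisym)
  show "total_degree f \<le> degree (vertical_poly f a x z)"
    by (rule le_degree) (simp add: coeff_vertical_poly_top assms)
  have "coeff (vertical_poly f a x z) k = 0" if "k > total_degree f" for k
    unfolding coeff_vertical_poly
    by (intro sum.neutral) (use that in \<open>auto simp: coeff_monom_linear_power\<close>)
  then show "degree (vertical_poly f a x z) \<le> total_degree f"
    by (intro degree_le) auto
qed

text \<open>
  The polynomials \<open>vertical_poly f a 1 z\<close> as one polynomial with coefficients in \<open>\<complex>[z]\<close>. The line over
  \<open>x \<noteq> 0\<close> corresponds to the parameter \<open>z = 1 / x\<close>, so that the line at infinity is the member \<open>z = 0\<close>.
\<close>
definition vertical_pencil :: "complex poly poly \<Rightarrow> complex \<Rightarrow> complex poly poly" where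
  "vertical_pencil f a = (\<Sum>(i, j)\<in>{(i, j). i + j \<le> total_degree f}.
     Polynomial.smult (monom (coeff (coeff f j) i) (total_degree f - (i + j))) (monom 1 j * [:1, [:a:]:] ^ i))"

lemma coeff_vertical_pencil:
  "coeff (vertical_pencil f a) k = (\<Sum>(i, j)\<in>{(i, j). i + j \<le> total_degree f}.
     monom (coeff (coeff f j) i) (total_degree f - (i + j)) * coeff (monom 1 j * [:1, [:a:]:] ^ i) k)"
  unfolding vertical_pencil_def coeff_sum by (intro sum.cong refl) auto

lemma map_poly_vertical_pencil:
  "map_poly (\<lambda>p. poly p z) (vertical_pencil f a) = vertical_poly f a 1 z"
proof (rule poly_eqI)
  fix k
  show "coeff (map_poly (\<lambda>p. poly p z) (vertical_pencil f a)) k = coeff (vertical_poly f a 1 z) k"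
    unfolding coeff_vertical_poly
    by (auto simp: coeff_map_poly coeff_vertical_pencil poly_sum coeff_monom_linear_power poly_monom poly_power
          intro!: sum.cong)
qed

lemma degree_vertical_pencil:
  assumes "homogenization f a 1 0 \<noteq> 0"
  shows "degree (vertical_pencil f a) = total_degree f"
proof (rule antisym)
  have "poly (coeff (vertical_pencil f a) (total_degree f)) 0 \<noteq> 0"
    using assms coeff_vertical_poly_top[of f a 1 0]
    by (simp add: coeff_map_poly flip: map_poly_vertical_pencil)
  then show "total_degree f \<le> degree (vertical_pencil f a)"
    by (intro le_degree) auto
  have "coeff (vertical_pencil f a) k = 0" if "k > total_degree f" for k
    unfolding coeff_vertical_pencil
    by (intro sum.neutral) (use that in \<open>auto simp: coeff_monom_linear_power\<close>)
  then show "degree (vertical_pencil f a) \<le> total_degree f"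
    by (intro degree_le) auto
qed

text \<open>
  The top degree form of \<open>f\<close> is not zero, hence neither is its dehomogenisation.
\<close>
lemma vertical_direction_exists:
  assumes "total_degree f > 0"
  obtains a where "homogenization f a 1 0 \<noteq> 0"
proof -
  define n where "n = total_degree f"
  define p where "p = (\<Sum>(i, j)\<in>{(i, j). i + j \<le> n}. monom (coeff (coeff f j) i * 0 ^ (n - (i + j))) i)"
  have p: "poly p a = homogenization f a 1 0" for a
    unfolding p_def n_def homogenization_def poly_sum
    by (intro sum.cong refl) (auto simp: poly_monom)
  obtain i j where ij: "coeff (coeff f j) i \<noteq> 0" "i + j = n"
    using total_degree_attained[OF assms] unfolding n_def by blast
  have "coeff p i = (\<Sum>(i', j')\<in>{(i, j). i + j \<le> n}. if i' = i then coeff (coeff f j') i' * 0 ^ (n - (i' + j')) else 0)"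
    unfolding p_def coeff_sum by (intro sum.cong refl) auto
  also have "\<dots> = (\<Sum>(i', j')\<in>{(i, j)}. coeff (coeff f j') i')"
    using ij by (intro sum.mono_neutral_cong_right finite_triangle) (auto simp: power_0_left split: if_splits)
  finally have "p \<noteq> 0" using ij by auto
  then have "finite {a. poly p a = 0}" by (rule poly_roots_finite)
  then have "{a. poly p a = 0} \<noteq> UNIV"
    by (metis infinite_UNIV_char_0)
  then show ?thesis using that p by auto
qed

text \<open>
  At a double root both the derivative in the direction \<open>(a, 1, 0)\<close> and, by Euler's identity, the one in the direction
  \<open>(x + a y, y, 0)\<close> vanish. These directions span the plane \<open>z = 0\<close>, so the curve would be singular
  or tangent to the line at infinity.
\<close>
lemma rsquarefree_at_infinity:
  assumes gp: "general_position_at_infinity f" and x: "x \<noteq> 0"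
  shows "rsquarefree (vertical_poly f a x 0)"
  unfolding rsquarefree_roots
proof (intro allI notI)
  fix y assume y: "poly (vertical_poly f a x 0) y = 0 \<and> poly (pderiv (vertical_poly f a x 0)) y = 0"
  define X where "X = x + a * y"
  have G0: "homogenization f X y 0 = 0" using y by (simp add: poly_vertical_poly X_def)
  have "((\<lambda>t. homogenization f (x + a * t) t 0) has_field_derivative
      (partial_x f X y 0 * a + partial_y f X y 0 * 1 + partial_z f X y 0 * 0)) (at y)"
    unfolding X_def by (rule DERIV_homogenization) (auto intro!: derivative_eq_intros)
  moreover have "((\<lambda>t. homogenization f (x + a * t) t 0) has_field_derivative 0) (at y)"
    using poly_DERIV[of "vertical_poly f a x 0" y] y by (simp add: poly_vertical_poly)
  ultimately have Gy: "partial_y f X y 0 = - a * partial_x f X y 0"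
    using DERIV_unique by (fastforce simp: add_eq_0_iff mult.commute)
  have "x * partial_x f X y 0 = 0"
    using euler_homogenization[of X f y 0] G0 Gy by (simp add: X_def algebra_simps)
  then have Gx: "partial_x f X y 0 = 0" using x by simp
  have grad: "gradient (homogenization f) (X, y, 0) = (0, 0, partial_z f X y 0)"
    by (simp add: gradient_homogenization Gx Gy)
  have "(X, y, 0) \<in> projective_completion f \<inter> line_at_infinity"
    using G0 x by (auto simp: projective_completion_def line_at_infinity_def X_def)
  then have "smooth_at f (X, y, 0)" "tangent_line f (X, y, 0) \<noteq> line_at_infinity"
    using gp by (auto simp: general_position_at_infinity_def)
  then show False
    by (auto simp: smooth_at_def tangent_line_def line_at_infinity_def grad)
qed

text \<open>
  The point \<open>(a, 1, 0)\<close> is not on the curve, and a neighbourhood of it in the projective plane has the shape of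
  the region in question.
\<close>
lemma far_from_curve:
  assumes a: "homogenization f a 1 0 \<noteq> 0"
  obtains M where "M > 0" "\<And>x y z. M * (norm z + norm x) < norm y \<Longrightarrow> homogenization f (x + a * y) y z \<noteq> 0"
proof -
  define g where "g = (\<lambda>p. homogenization f (fst p + a) 1 (snd p))"
  have "continuous_on UNIV g"
    unfolding g_def by (intro continuous_on_homogenization continuous_intros)
  then have "isCont g 0" using continuous_on_eq_continuous_at[OF open_UNIV] by blast
  moreover have "g 0 \<noteq> 0" using a by (simp add: g_def)
  ultimately obtain e where e: "e > 0" "\<And>p. dist p 0 < e \<Longrightarrow> g p \<noteq> 0"
    using continuous_at_avoid[of 0 g 0] by (metis dist_commute)
  have "homogenization f (x + a * y) y z \<noteq> 0" if "1 / e * (norm z + norm x) < norm y" for x y z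
  proof -
    have "0 \<le> 1 / e * (norm z + norm x)" using e by simp
    then have y: "y \<noteq> 0" using that by auto
    have "norm (x / y, z / y) \<le> norm (x / y) + norm (z / y)" by (rule norm_Pair_le)
    also have "\<dots> = (norm z + norm x) / norm y" by (simp add: norm_divide add_divide_distrib)
    also have "\<dots> < e" using that y e by (simp add: field_simps)
    finally have "g (x / y, z / y) \<noteq> 0" by (intro e) simp
    then show ?thesis
      using homogenization_scale[of f y "x / y + a" 1 "z / y"] y by (simp add: g_def algebra_simps)
  qed
  then show ?thesis using e(1) by (intro that[of "1 / e"]) auto
qed

section \<open>Curves in general position at infinity\<close>

theorem mainTheorem4:
  fixes F :: "('a, 'b) monoid_scheme" and X :: "'a set"
  assumes "group F" and "free_basis F X" and "infinite X \<or> card X \<ge> 3"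
  shows "\<not> (\<exists>f :: complex poly poly.
           reduced_plane_curve f \<and> general_position_at_infinity f \<and>
           (\<exists>b \<in> - affine_curve f. fundamental_group (- affine_curve f) b \<cong> F))"
proof
  assume "\<exists>f :: complex poly poly.
           reduced_plane_curve f \<and> general_position_at_infinity f \<and>
           (\<exists>b \<in> - affine_curve f. fundamental_group (- affine_curve f) b \<cong> F)"
  then obtain f b where f: "total_degree f > 0" "general_position_at_infinity f"
    and b: "b \<in> - affine_curve f" and iso: "fundamental_group (- affine_curve f) b \<cong> F"
    by (auto simp: reduced_plane_curve_def)
  have "\<not> is_singleton X" "X \<noteq> {}"
    using assms(3) by (auto simp: is_singleton_def)
  then have "\<exists>x0\<in>X. \<exists>x1\<in>X. x0 \<noteq> x1"
    by (metis is_singletonI')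
  then obtain x0 x1 where X: "x0 \<in> X" "x1 \<in> X" "x0 \<noteq> x1" by blast
  define n where "n = total_degree f"
  obtain a where a: "homogenization f a 1 0 \<noteq> 0" using vertical_direction_exists[OF f(1)] .
  obtain M where M: "M > 0"
    "\<And>x y z. M * (norm z + norm x) < norm y \<Longrightarrow> homogenization f (x + a * y) y z \<noteq> 0"
    using far_from_curve[OF a] by metis
  define H where "H = (\<lambda>x y z. homogenization f (x + a * y) y z)"
  have H_poly: "H x y z = poly (vertical_poly f a x z) y" for x y z
    by (simp add: H_def poly_vertical_poly)
  have H_scale: "H (l * x) (l * y) (l * z) = l ^ n * H x y z" for l x y z
    using homogenization_scale[of f l "x + a * y" y z] by (simp add: H_def n_def algebra_simps)
  have card_roots: "card {y. H x y z = 0} = n" if "rsquarefree (vertical_poly f a x z)" for x z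
    using rsquarefree_card_roots[OF that] degree_vertical_poly[OF a] by (simp add: H_poly n_def)
  interpret transverse_curve H "vertical_poly f a" n "homogenization f a 1 0" M
  proof
    show "continuous_on UNIV (\<lambda>(x, y, z). H x y z)"
      unfolding H_def split_def by (intro continuous_on_homogenization continuous_intros)
    show "lead_coeff (vertical_poly f a x z) = homogenization f a 1 0" for x z
      by (simp add: degree_vertical_poly[OF a] coeff_vertical_poly_top)
    show "card {y. H x y 0 = 0} = n" if "x \<noteq> 0" for x
      by (intro card_roots rsquarefree_at_infinity f that)
    have "finite {z. \<not> rsquarefree (vertical_poly f a 1 z)}"
      using finite_not_rsquarefree[of "vertical_pencil f a" 0] rsquarefree_at_infinity[OF f(2), of 1 a] f(1)
      by (simp add: map_poly_vertical_pencil degree_vertical_poly[OF a] degree_vertical_pencil[OF a])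
    moreover have bad: "x \<in> insert 0 (inverse ` {z. \<not> rsquarefree (vertical_poly f a 1 z)})"
      if "card {y. H x y 1 = 0} \<noteq> n" for x
    proof (rule ccontr)
      assume x: "\<not> ?thesis"
      then have "x \<noteq> 0" by simp
      have "rsquarefree (vertical_poly f a 1 (1 / x))"
        using x by (auto simp: image_iff inverse_eq_divide)
      then have "card {y. H 1 y (1 / x) = 0} = n" by (rule card_roots)
      moreover have "{y. H x y 1 = 0} = (\<lambda>y. x * y) ` {y. H 1 y (1 / x) = 0}"
      proof (intro equalityI subsetI)
        fix y assume "y \<in> {y. H x y 1 = 0}"
        then show "y \<in> (\<lambda>y. x * y) ` {y. H 1 y (1 / x) = 0}"
          using H_scale[of x 1 "y / x" "1 / x"] \<open>x \<noteq> 0\<close>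
          by (intro image_eqI[of _ _ "y / x"]) auto
      next
        fix y assume "y \<in> (\<lambda>y. x * y) ` {y. H 1 y (1 / x) = 0}"
        then show "y \<in> {y. H x y 1 = 0}"
          using H_scale[of x 1 _ "1 / x"] \<open>x \<noteq> 0\<close> by auto
      qed
      moreover have "inj_on (\<lambda>y. x * y) A" for A using \<open>x \<noteq> 0\<close> by (auto simp: inj_on_def)
      ultimately show False using that by (simp add: card_image)
    qed
    moreover from bad have "{x. card {y. H x y 1 = 0} \<noteq> n} \<subseteq> insert 0 (inverse ` {z. \<not> rsquarefree (vertical_poly f a 1 z)})"
      by (intro subsetI) (simp only: mem_Collect_eq)
    ultimately show "finite {x. card {y. H x y 1 = 0} \<noteq> n}"
      by (meson finite_subset finite_insert finite_imageI)
    show "degree (vertical_poly f a x z) = n" for x z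
      by (simp add: degree_vertical_poly[OF a] n_def)
    show "H x y z \<noteq> 0" if "M * (norm z + norm x) < norm y" for x y z
      unfolding H_def using that by (rule M(2))
    show "n > 0" using f(1) by (simp add: n_def)
  qed (fact H_scale H_poly[symmetric] a M(1))+
  define T where "T = (\<lambda>(x, y). (x + a * y, y :: complex))"
  define T' where "T' = (\<lambda>(x, y). (x - a * y, y :: complex))"
  have inv: "T (T' p) = p" "T' (T p) = p" for p by (auto simp: T_def T'_def split: prod.split)
  have cont: "continuous_on A T" "continuous_on A T'" for A
    unfolding T_def T'_def case_prod_unfold by (intro continuous_intros)+
  have compl: "curve_compl = {(x, y). poly2 f (x + a * y) y \<noteq> 0}"
    unfolding curve_compl_def by (simp add: H_def homogenization_1)
  have mem: "T p \<in> - affine_curve f \<longleftrightarrow> p \<in> curve_compl" for p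
    unfolding compl by (auto simp: T_def affine_curve_def)
  have mem': "T' p \<in> curve_compl \<longleftrightarrow> p \<in> - affine_curve f" for p
    using mem[of "T' p"] by (simp add: inv)
  define p where "p = T' b"
  have p: "p \<in> curve_compl" "T p = b" using b by (simp_all add: p_def mem' inv)
  have loop_p: "path (rotation_loop p)" "path_image (rotation_loop p) \<subseteq> curve_compl" "pathstart (rotation_loop p) = p" "pathfinish (rotation_loop p) = p"
    using p by simp_all
  have "\<not> fundamental_group (- affine_curve f) b \<cong> F"
  proof (rule center_loop_not_free[OF b _ _ _ assms(1,2) X])
    show "T \<circ> rotation_loop p \<in> loops_at (- affine_curve f) b"
    proof -
      have "T ` path_image (rotation_loop p) \<subseteq> - affine_curve f" using mem loop_p(2) by blast
      then show ?thesis
        using path_continuous_image[OF loop_p(1) cont(1)] loop_p p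
        by (simp add: loops_at_def path_image_compose pathstart_compose pathfinish_compose)
    qed
    show "homotopic_paths (- affine_curve f) (q +++ (T \<circ> rotation_loop p)) ((T \<circ> rotation_loop p) +++ q)"
      if q: "q \<in> loops_at (- affine_curve f) b" for q
    proof -
      have "central (T' \<circ> q)"
        using q path_continuous_image[OF _ cont(2)]
        by (intro central_all) (auto simp: loops_at_def path_image_compose mem')
      moreover have "pathstart (T' \<circ> q) = p" "pathfinish (T' \<circ> q) = p"
        using q by (auto simp: loops_at_def pathstart_compose pathfinish_compose p_def)
      ultimately have "homotopic_paths curve_compl ((T' \<circ> q) +++ rotation_loop p) (rotation_loop p +++ (T' \<circ> q))"
        by (simp add: commutes_along_def)
      then have "homotopic_paths (- affine_curve f) (T \<circ> ((T' \<circ> q) +++ rotation_loop p)) (T \<circ> (rotation_loop p +++ (T' \<circ> q)))"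
        by (rule homotopic_paths_continuous_image) (use mem cont in auto)
      moreover have "T \<circ> (T' \<circ> q) = q" by (auto simp: inv)
      ultimately show ?thesis by (simp add: path_compose_join)
    qed
    show "\<not> homotopic_paths (- affine_curve f) (T \<circ> rotation_loop p) (linepath b b)"
    proof
      assume "homotopic_paths (- affine_curve f) (T \<circ> rotation_loop p) (linepath b b)"
      then have "homotopic_paths curve_compl (T' \<circ> (T \<circ> rotation_loop p)) (T' \<circ> linepath b b)"
        by (rule homotopic_paths_continuous_image) (use mem' cont in auto)
      moreover have "T' \<circ> (T \<circ> rotation_loop p) = rotation_loop p" "T' \<circ> linepath b b = linepath p p"
        by (auto simp: inv linepath_refl p_def)
      ultimately show False using rotation_loop_nontrivial[OF p(1)] by simp
    qed
  qed
  then show False using iso by contradiction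
qed

end
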